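(* Let $f\colon\mathbb{R}^n\to\mathbb{R}$ be locally Lipschitz, let $\{x_i\}_{i\in\mathbb{N}}$ be a bounded sequence generated by the subgradient method, and let $\gamma\colon\mathbb{R}_{\geq0}\to\mathbb{R}^n$ be its interpolating curve. Let $\{I_i\}_{i\geq1}$ be a sequence of disjoint, bounded intervals in $\mathbb{R}_{\geq0}$ with $\lim_{i\to+\infty}|I_i|=+\infty$, and write $G_k=I_1\cup I_2\cup\dots\cup I_k$. Suppose that for some sequence $\{k_i\}_i\subset\mathbb{N}$ with $k_i\to+\infty$ the weak* limit $$\mu=\lim_{i\to+\infty}\mu_{\gamma|_{G_{k_i}}}$$ exists (so that $\mu$ is a closed probability measure). Let $U\subset\mathbb{R}^n$ be a bounded open set containing $\pi(\operatorname{supp}\mu)$, and let $\nu$ be a Borel probability measure on the space $\mathsf{Lip}(U)$ of Lipschitz curves $\mathbb{R}\to U$ that is invariant under the time-translation $\tau_t$ for all $t\in\mathbb{R}$ and satisfies $$\int_{\mathbb{R}^n}\phi(x,\bar v_x)\,d(\pi_*\mu)(x)=\int_{\mathsf{Lip}(U)}\phi(\beta(0),\beta'(0))\,d\nu(\beta)$$ for any measurable $\phi\colon\mathbb{R}^n\times\mathbb{R}^n\to\mathbb{R}$, where $\bar v_x$ is the centroid field of $\mu$. Then $\nu$-almost every curve $\beta$ satisfies $$-\beta'(t)\in\partial^cf(\beta(t))$$ for almost every $t\in\mathbb{R}$.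
   Context: **Clarke subdifferential.** For a locally Lipschitz $f\colon\mathbb{R}^n\to\mathbb{R}$, $\partial^c f(x)$ is the closed convex hull of the set of $v\in\mathbb{R}^n$ for which there is a sequence $y_k\to x$ of differentiability points of $f$ with $\nabla f(y_k)\to v$. **Subgradient method.** $\{\varepsilon_i\}_{i\in\mathbb{N}}$ is a sequence of positive step sizes with $\sum_{i=0}^\infty\varepsilon_i=+\infty$ and $\varepsilon_i\searrow0$ (nonincreasing, converging to $0$). Given $x_0\in\mathbb{R}^n$, a subgradient sequence is any sequence with $x_{i+1}=x_i-\varepsilon_i v_i$, where $v_i$ is chosen freely in $\partial^c f(x_i)$, $i\geq0$. **Interpolating curve.** Put $t_0=0$ and $t_i=\sum_{j=0}^{i-1}\varepsilon_j$ for $i\geq1$. The interpolating curve is the continuous piecewise affine curve $\gamma\colon\mathbb{R}_{\geq0}\to\mathbb{R}^n$ with $\gamma(t_i)=x_i$ and $\gamma'(t)=-v_i$ for $t_i<t<t_{i+1}$. **Measures.** For a bounded measurable $B\subset\mathbb{R}_{\geq0}$ of positive Lebesgue measure $|B|$, $\mu_{\gamma|_B}=\frac1{|B|}(\gamma,\gamma')_*\mathsf{Leb}_B$ is the probability measure on $\mathbb{R}^n\times\mathbb{R}^n$ given by $\int\phi\,d\mu_{\gamma|_B}=\frac1{|B|}\int_B\phi(\gamma(t),\gamma'(t))\,dt$. Weak* convergence $\mu_i\to\mu$ means $\int\phi\,d\mu_i\to\int\phi\,d\mu$ for all continuous $\phi$. A compactly supported, positive Radon measure $\mu$ on $\mathbb{R}^n\times\mathbb{R}^n$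 is closed if $\int\nabla g(x)\cdot v\,d\mu(x,v)=0$ for all $g\in C^\infty(\mathbb{R}^n)$. With $\pi(x,v)=x$, the disintegration of $\mu$ is $\mu=\int_{\mathbb{R}^n}\mu_x\,d(\pi_*\mu)(x)$ with $\mu_x$ probability measures on $\mathbb{R}^n$ (in the velocity variable), and the centroid field is $\bar v_x=\int_{\mathbb{R}^n}v\,d\mu_x(v)$. **Curve space.** $\mathsf{Lip}(U)$ is the set of Lipschitz curves $\beta\colon\mathbb{R}\to U$ with the supremum norm; $\tau_t(\beta)(s)=\beta(s+t)$. *)

theory Defs
  imports "HOL-Probability.Probability"
begin

definition locally_Lipschitz :: "('a::metric_space \<Rightarrow> 'b::metric_space) \<Rightarrow> bool" where
  "locally_Lipschitz f \<longleftrightarrow> (\<forall>x. \<exists>u>0. \<exists>L. L-lipschitz_on (cball x u) f)"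

definition clarke_subdiff :: "('a::euclidean_space \<Rightarrow> real) \<Rightarrow> 'a \<Rightarrow> 'a set" where
  "clarke_subdiff f x = closure (convex hull
     {v. \<exists>y g. y \<longlonglongrightarrow> x \<and> (\<forall>k::nat. GDERIV f (y k) :> g k) \<and> g \<longlonglongrightarrow> v})"

definition step_sizes :: "(nat \<Rightarrow> real) \<Rightarrow> bool" where
  "step_sizes \<epsilon> \<longleftrightarrow> (\<forall>i. \<epsilon> i > 0) \<and> decseq \<epsilon> \<and> \<epsilon> \<longlonglongrightarrow> 0
     \<and> filterlim (\<lambda>n. \<Sum>i<n. \<epsilon> i) at_top sequentially"

definition subgradient_sequence ::
  "('a::euclidean_space \<Rightarrow> real) \<Rightarrow> (nat \<Rightarrow> real) \<Rightarrow> (nat \<Rightarrow> 'a) \<Rightarrow> (nat \<Rightarrow> 'a) \<Rightarrow> bool" where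
  "subgradient_sequence f \<epsilon> x v \<longleftrightarrow>
     (\<forall>i. v i \<in> clarke_subdiff f (x i) \<and> x (Suc i) = x i - \<epsilon> i *\<^sub>R v i)"

definition node_time :: "(nat \<Rightarrow> real) \<Rightarrow> nat \<Rightarrow> real" where
  "node_time \<epsilon> i = (\<Sum>j<i. \<epsilon> j)"

(* The curve lives on the half-line [0, infinity); the values of gamma at negative
   times are unconstrained and are never used. *)
definition interpolating_curve ::
  "(nat \<Rightarrow> real) \<Rightarrow> (nat \<Rightarrow> 'a::euclidean_space) \<Rightarrow> (nat \<Rightarrow> 'a) \<Rightarrow> (real \<Rightarrow> 'a) \<Rightarrow> bool" where
  "interpolating_curve \<epsilon> x v \<gamma> \<longleftrightarrow>
     continuous_on {0..} \<gamma> \<and> (\<forall>i. \<gamma> (node_time \<epsilon> i) = x i) \<and>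
     (\<forall>i. \<forall>t\<in>{node_time \<epsilon> i<..<node_time \<epsilon> (Suc i)}. (\<gamma> has_vector_derivative - v i) (at t))"

(* At the (countably many) times where the interpolating curve is not differentiable,
   vector_derivative has an unspecified value; this does not affect the measure. *)
definition curve_measure :: "(real \<Rightarrow> 'a::euclidean_space) \<Rightarrow> real set \<Rightarrow> ('a \<times> 'a) measure" where
  "curve_measure \<gamma> B =
     distr (uniform_measure (lebesgue_on B) B) borel (\<lambda>t. (\<gamma> t, vector_derivative \<gamma> (at t)))"

definition weak_star_limit :: "(nat \<Rightarrow> 'b::topological_space measure) \<Rightarrow> 'b measure \<Rightarrow> bool" where
  "weak_star_limit M \<mu> \<longleftrightarrow>
     (\<forall>\<phi>::'b \<Rightarrow> real. continuous_on UNIV \<phi> \<longrightarrow> (\<lambda>i. LINT z|M i. \<phi> z) \<longlonglongrightarrow> (LINT z|\<mu>. \<phi> z))"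

definition measure_support :: "'b::topological_space measure \<Rightarrow> 'b set" where
  "measure_support \<mu> = {z. \<forall>V. open V \<and> z \<in> V \<longrightarrow> emeasure \<mu> V > 0}"

primrec Ck_fun :: "nat \<Rightarrow> ('a::euclidean_space \<Rightarrow> real) \<Rightarrow> bool" where
  "Ck_fun 0 g \<longleftrightarrow> continuous_on UNIV g"
| "Ck_fun (Suc k) g \<longleftrightarrow> (\<forall>x. g differentiable (at x)) \<and>
     (\<forall>b\<in>Basis. Ck_fun k (\<lambda>x. frechet_derivative g (at x) b))"

definition smooth_fun :: "('a::euclidean_space \<Rightarrow> real) \<Rightarrow> bool" where
  "smooth_fun g \<longleftrightarrow> (\<forall>k. Ck_fun k g)"

(* On a Euclidean space, a Radon measure is a Borel measure that is finite on compact sets. *)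
definition closed_measure :: "('a::euclidean_space \<times> 'a) measure \<Rightarrow> bool" where
  "closed_measure \<mu> \<longleftrightarrow>
     sets \<mu> = sets borel \<and> (\<forall>K. compact K \<longrightarrow> emeasure \<mu> K < \<infinity>) \<and>
     compact (measure_support \<mu>) \<and>
     (\<forall>g Dg. smooth_fun g \<and> (\<forall>x. GDERIV g x :> Dg x) \<longrightarrow> (LINT (x, v)|\<mu>. Dg x \<bullet> v) = 0)"

definition disintegration :: "('a::euclidean_space \<times> 'a) measure \<Rightarrow> ('a \<Rightarrow> 'a measure) \<Rightarrow> bool" where
  "disintegration \<mu> \<kappa> \<longleftrightarrow>
     \<kappa> \<in> measurable borel (prob_algebra borel) \<and>
     (\<forall>A\<in>sets borel. emeasure \<mu> A =
        (\<integral>\<^sup>+x. emeasure (\<kappa> x) {v. (x, v) \<in> A} \<partial>distr \<mu> borel fst))"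

definition centroid :: "('a \<Rightarrow> 'a::euclidean_space measure) \<Rightarrow> 'a \<Rightarrow> 'a" where
  "centroid \<kappa> x = (LINT v|\<kappa> x. v)"

(* For bounded U every Lipschitz curve into U is a bounded continuous function, and the metric
   of the type of bounded continuous functions is the supremum metric. *)
definition Lip_curves :: "'a::euclidean_space set \<Rightarrow> (real \<Rightarrow>\<^sub>C 'a) set" where
  "Lip_curves U = {\<beta>. range (apply_bcontfun \<beta>) \<subseteq> U \<and> (\<exists>L. L-lipschitz_on UNIV (apply_bcontfun \<beta>))}"

definition translate :: "real \<Rightarrow> (real \<Rightarrow>\<^sub>C 'a::euclidean_space) \<Rightarrow> (real \<Rightarrow>\<^sub>C 'a)" where
  "translate t \<beta> = Bcontfun (\<lambda>s. apply_bcontfun \<beta> (s + t))"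

lemma apply_translate [simp]:
  "apply_bcontfun (translate t \<beta>) s = apply_bcontfun \<beta> (s + t)"
proof -
  have "continuous_on UNIV (\<lambda>s. apply_bcontfun \<beta> (s + t))"
    by (intro continuous_on_compose2[OF continuous_on_apply_bcontfun[of UNIV \<beta>]] continuous_intros) auto
  moreover have "bounded (range (\<lambda>s. apply_bcontfun \<beta> (s + t)))"
    by (rule bounded_subset[OF bounded_apply_bcontfun[of \<beta>]]) auto
  ultimately show ?thesis
    by (simp add: translate_def Bcontfun_inverse bcontfun_def)
qed

end

theory Submission
  imports Defs
begin

text \<open>The velocity of the interpolating curve at time \<open>t\<close> is \<open>- v\<^sub>i\<close> with \<open>v\<^sub>i \<in> \<partial>\<^sup>c f (x\<^sub>i)\<close>, and
  \<open>\<gamma> t\<close> is within \<open>\<epsilon>\<^sub>i \<parallel>v\<^sub>i\<parallel> \<rightarrow> 0\<close> of \<open>x\<^sub>i\<close>. As the graph of \<open>\<partial>\<^sup>c f\<close> is closed, the limit measure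
  \<open>\<mu>\<close> is carried by the pairs \<open>(x, v)\<close> with \<open>- v \<in> \<partial>\<^sup>c f x\<close>; the values of \<open>\<partial>\<^sup>c f\<close> are convex,
  so the centroid field satisfies the same inclusion. Through the identity
  linking \<open>\<mu>\<close> and \<open>\<nu>\<close>, almost every curve satisfies the inclusion at time 0, by stationarity
  at every fixed time, and by Fubini at almost every time. Lipschitz curves are almost
  everywhere differentiable by a Vitali covering argument. Closedness of \<open>\<mu>\<close> holds because
  the integral of a gradient along each interval stays bounded while the lengths tend to infinity.\<close>

section \<open>Almost everywhere differentiability of Lipschitz curves\<close>

text \<open>The identity linking \<open>\<mu>\<close> and \<open>\<nu>\<close> speaks of
  \<open>vector_derivative\<close> at time 0, an arbitrary value where no derivative exists. The
  inclusion at time 0 therefore concerns a genuine derivative only once almost every curve is known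
  to be differentiable there; this is what the differentiability theorem for Lipschitz curves is
  for. Fubini needs joint measurability in curve and time. Since the supremum norm makes the curve
  space nonseparable, derivative and differentiability are rebuilt from countably many evaluations:
  a limit along increments \<open>1 / (n + 1)\<close>, tested on rational increments. To locate the
  mass of \<open>\<mu>\<close>, the test function is \<open>min 1 (infdist z S)\<close>: continuous,
  bounded, and zero exactly on a nonempty closed \<open>S\<close>. If its time averages vanish,
  \<open>\<mu>\<close> is carried by \<open>S\<close>. A compact set containing all positions and
  velocities gives compact support and integrable velocities; the graph of the negated
  subdifferential gives the inclusion.\<close>

lemma emeasure_mult_disjoint_UN_mono:
  assumes "countable C" "disjoint_family_on X C"
    and "\<And>i. i \<in> C \<Longrightarrow> X i \<in> sets M" "\<And>i. i \<in> C \<Longrightarrow> X i \<in> sets N"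
    and "\<And>i. i \<in> C \<Longrightarrow> a * emeasure M (X i) \<le> b * emeasure N (X i)"
  shows "a * emeasure M (\<Union>i\<in>C. X i) \<le> b * emeasure N (\<Union>i\<in>C. X i)"
proof -
  have "a * emeasure M (\<Union>i\<in>C. X i) = (\<integral>\<^sup>+i. a * emeasure M (X i) \<partial>count_space C)"
    using assms by (subst emeasure_UN_countable) (auto simp: nn_integral_cmult)
  also have "\<dots> \<le> (\<integral>\<^sup>+i. b * emeasure N (X i) \<partial>count_space C)"
    using assms(5) by (intro nn_integral_mono) auto
  also have "\<dots> = b * emeasure N (\<Union>i\<in>C. X i)"
    using assms by (subst emeasure_UN_countable) (auto simp: nn_integral_cmult)
  finally show ?thesis .
qed

text \<open>Continuity of \<open>F\<close> excludes atoms, so the endpoints carry no mass. Open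
  intervals are the form in which the Vitali theorem supplies its covers.\<close>

lemma emeasure_interval_measure_ball:
  fixes F :: "real \<Rightarrow> real"
  assumes "mono F" "continuous_on UNIV F" "0 \<le> r"
  shows "emeasure (interval_measure F) (ball c r) = F (c + r) - F (c - r)"
proof -
  have mono: "\<And>x y. x \<le> y \<Longrightarrow> F x \<le> F y"
    using assms(1) by (simp add: monoD)
  have "{c - r .. c + r} = ball c r \<union> ({c - r} \<union> {c + r})"
    using assms(3) by (auto simp: dist_real_def)
  moreover have "{y} \<in> null_sets (interval_measure F)" for y
    using emeasure_interval_measure_Icc[of y y F] assms mono by (simp add: null_setsI)
  ultimately have "emeasure (interval_measure F) {c - r .. c + r} = emeasure (interval_measure F) (ball c r)"
    by (metis emeasure_Un_null_set null_sets.Un sets_interval_measure borel_open open_ball)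
  then show ?thesis
    using emeasure_interval_measure_Icc[of "c - r" "c + r" F] assms mono by simp
qed

text \<open>Cover \<open>E\<close> up to a null set by disjoint intervals with quotient at most \<open>p\<close>, and cover it again
  inside these by disjoint intervals with quotient at least \<open>q\<close>. Comparing the increments of \<open>F\<close>
  gives \<open>q |E| \<le> p |E|\<close>.\<close>

lemma negligible_incompatible_difference_quotients:
  fixes F :: "real \<Rightarrow> real"
  assumes F: "mono F" "continuous_on UNIV F"
    and E: "E \<in> sets lebesgue" "bounded E" and pq: "0 \<le> p" "p < q"
    and lo: "\<And>x d. x \<in> E \<Longrightarrow> d > 0 \<Longrightarrow> \<exists>c r. x \<in> ball c r \<and> r < d \<and> F (c + r) - F (c - r) \<le> p * (2 * r)"
    and hi: "\<And>x d. x \<in> E \<Longrightarrow> d > 0 \<Longrightarrow> \<exists>c r. x \<in> ball c r \<and> r < d \<and> q * (2 * r) \<le> F (c + r) - F (c - r)"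
  shows "negligible E"
proof -
  define M where "M = interval_measure F"
  have M_ball: "emeasure M (ball c r) = ennreal (F (c + r) - F (c - r))" if "0 < r" for c r
    unfolding M_def using emeasure_interval_measure_ball F that by simp
  have L_ball: "emeasure lborel (ball c r) = ennreal (2 * r)" if "0 < r" for c r :: real
    using that by (simp add: ball_eq_greaterThanLessThan)
  have [simp]: "sets M = sets borel"
    by (simp add: M_def)
  \<comment> \<open>Boundedness serves finiteness: \<open>q |E| \<le> p |E|\<close> with
    \<open>p < q\<close> forces \<open>|E| = 0\<close> only if \<open>|E|\<close> is finite.\<close>
  have fin: "emeasure lebesgue E < \<infinity>"
    using bounded_set_imp_lmeasurable[OF E(2,1)] by (simp add: fmeasurable_def del: emeasure_completion)
  have sub_ball: "\<exists>\<delta>>0. \<forall>c r. x \<in> ball c r \<longrightarrow> r < \<delta> \<longrightarrow> ball c r \<subseteq> V" if "open V" "x \<in> V" for x and V :: "real set"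
  proof -
    obtain \<delta> where \<delta>: "\<delta> > 0" "ball x \<delta> \<subseteq> V"
      using \<open>open V\<close> \<open>x \<in> V\<close> open_contains_ball by blast
    show ?thesis
    \<comment> \<open>Half of the radius suffices, as two points of a ball of radius
      \<open>r\<close> are less than \<open>2 r\<close> apart.\<close>
    proof (intro exI[of _ "\<delta> / 2"] conjI allI impI subsetI)
      fix c r y assume "x \<in> ball c r" "r < \<delta> / 2" "y \<in> ball c r"
      then have "dist x y < \<delta>"
        by (simp add: dist_real_def)
      then show "y \<in> V"
        using \<delta> by auto
    qed (use \<delta> in auto)
  qed
  \<comment> \<open>With the first cover \<open>W\<close>, the second cover \<open>Z\<close> and an
    open \<open>T\<close> exceeding \<open>E\<close> by less than \<open>e\<close>, so that
    \<open>Z\<close> lies in \<open>W\<close> and \<open>W\<close> in \<open>T\<close>, the chain is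
    \<open>q |E| \<le> q |Z| \<le> M Z \<le> M W \<le> p |W| \<le> p |T| \<le> p (|E| +
    e)\<close>.\<close>
  have main: "ennreal q * emeasure lebesgue E \<le> ennreal p * (emeasure lebesgue E + ennreal e)" if "e > 0" for e
  proof -
    obtain T where T: "open T" "E \<subseteq> T" "T - E \<in> lmeasurable" "emeasure lebesgue (T - E) < ennreal e"
      using sets_lebesgue_outer_open[OF E(1) \<open>e > 0\<close>] .
    define K where "K = {(c, r). 0 < r \<and> ball c r \<subseteq> T \<and> F (c + r) - F (c - r) \<le> p * (2 * r)}"
    have "\<exists>i. i \<in> K \<and> x \<in> ball (fst i) (snd i) \<and> snd i < d" if x: "x \<in> E" and "d > 0" for x d
    proof -
      obtain \<delta> where \<delta>: "\<delta> > 0" "\<And>c r. x \<in> ball c r \<Longrightarrow> r < \<delta> \<Longrightarrow> ball c r \<subseteq> T"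
        using sub_ball[of T x] T x by blast
      obtain c r where "x \<in> ball c r" "r < min d \<delta>" "F (c + r) - F (c - r) \<le> p * (2 * r)"
        using lo[OF x, of "min d \<delta>"] \<open>d > 0\<close> \<open>\<delta> > 0\<close> by auto
      moreover from this have "0 < r"
        by (metis ball_empty empty_iff not_le)
      ultimately show ?thesis
        using \<delta> by (intro exI[of _ "(c, r)"]) (auto simp: K_def)
    qed
    then obtain C where C: "countable C" "C \<subseteq> K"
      "pairwise (\<lambda>i j. disjnt (ball (fst i) (snd i)) (ball (fst j) (snd j))) C"
      "negligible (E - (\<Union>i\<in>C. ball (fst i) (snd i)))"
      by (rule Vitali_covering_theorem_balls[of E K fst snd])
    define W where "W = (\<Union>i\<in>C. ball (fst i) (snd i))"
    have "open W"
      by (auto simp: W_def)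
    then have [simp]: "W \<in> sets borel"
      by simp
    have "W \<subseteq> T"
      unfolding W_def
    proof (intro UN_least)
      show "ball (fst i) (snd i) \<subseteq> T" if "i \<in> C" for i
        using subsetD[OF C(2) that] by (simp add: K_def case_prod_unfold)
    qed
    have W_le: "1 * emeasure M W \<le> ennreal p * emeasure lborel W"
      unfolding W_def
    proof (rule emeasure_mult_disjoint_UN_mono[OF C(1)])
      show "disjoint_family_on (\<lambda>i. ball (fst i) (snd i)) C"
        using C(3) by (auto simp: disjoint_family_on_def pairwise_def disjnt_def)
      show "1 * emeasure M (ball (fst i) (snd i)) \<le> ennreal p * emeasure lborel (ball (fst i) (snd i))" if "i \<in> C" for i
        using that C(2) pq by (auto simp: K_def M_ball L_ball simp flip: ennreal_mult' intro!: ennreal_leI)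
    qed auto
    \<comment> \<open>Keeping the second family inside \<open>W\<close> bounds its mass by
      \<open>M W\<close>. Covering \<open>E \<inter> W\<close> instead of \<open>E\<close> loses
      only a null set.\<close>
    define K' where "K' = {(c, r). 0 < r \<and> ball c r \<subseteq> W \<and> q * (2 * r) \<le> F (c + r) - F (c - r)}"
    have "\<exists>i. i \<in> K' \<and> x \<in> ball (fst i) (snd i) \<and> snd i < d" if x: "x \<in> E \<inter> W" and "d > 0" for x d
    proof -
      obtain \<delta> where \<delta>: "\<delta> > 0" "\<And>c r. x \<in> ball c r \<Longrightarrow> r < \<delta> \<Longrightarrow> ball c r \<subseteq> W"
        using sub_ball[of W x] \<open>open W\<close> x by blast
      obtain c r where "x \<in> ball c r" "r < min d \<delta>" "q * (2 * r) \<le> F (c + r) - F (c - r)"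
        using hi[of x "min d \<delta>"] x \<open>d > 0\<close> \<open>\<delta> > 0\<close> by auto
      moreover from this have "0 < r"
        by (metis ball_empty empty_iff not_le)
      ultimately show ?thesis
        using \<delta> by (intro exI[of _ "(c, r)"]) (auto simp: K'_def)
    qed
    then obtain D where D: "countable D" "D \<subseteq> K'"
      "pairwise (\<lambda>i j. disjnt (ball (fst i) (snd i)) (ball (fst j) (snd j))) D"
      "negligible (E \<inter> W - (\<Union>i\<in>D. ball (fst i) (snd i)))"
      by (rule Vitali_covering_theorem_balls[of "E \<inter> W" K' fst snd])
    define Z where "Z = (\<Union>i\<in>D. ball (fst i) (snd i))"
    have [simp]: "Z \<in> sets borel"
      unfolding Z_def by (intro borel_open) auto
    have "Z \<subseteq> W"
      unfolding Z_def
    proof (intro UN_least)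
      show "ball (fst i) (snd i) \<subseteq> W" if "i \<in> D" for i
        using subsetD[OF D(2) that] by (simp add: K'_def case_prod_unfold)
    qed
    have Z_le: "ennreal q * emeasure lborel Z \<le> 1 * emeasure M Z"
      unfolding Z_def
    proof (rule emeasure_mult_disjoint_UN_mono[OF D(1)])
      show "disjoint_family_on (\<lambda>i. ball (fst i) (snd i)) D"
        using D(3) by (auto simp: disjoint_family_on_def pairwise_def disjnt_def)
      show "ennreal q * emeasure lborel (ball (fst i) (snd i)) \<le> 1 * emeasure M (ball (fst i) (snd i))" if "i \<in> D" for i
        using that D(2) pq by (auto simp: K'_def M_ball L_ball simp flip: ennreal_mult' intro!: ennreal_leI)
    qed auto
    have "negligible (E - Z)"
      by (rule negligible_subset[OF negligible_Un[OF C(4) D(4)]]) (auto simp: W_def Z_def)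
    then have null: "E - Z \<in> null_sets lebesgue"
      by (simp add: negligible_iff_null_sets)
    have "emeasure lebesgue E \<le> emeasure lebesgue (Z \<union> (E - Z))"
      by (intro emeasure_mono sets.Un sets.Diff) (use E(1) in auto)
    also have "\<dots> = emeasure lborel Z"
      using emeasure_Un_null_set[OF _ null, of Z] by (simp del: Un_Diff_cancel)
    finally have "ennreal q * emeasure lebesgue E \<le> ennreal q * emeasure lborel Z"
      by (intro mult_left_mono) auto
    also have "\<dots> \<le> emeasure M W"
      using Z_le emeasure_mono[OF \<open>Z \<subseteq> W\<close>, of M] by simp
    also have "\<dots> \<le> ennreal p * emeasure lebesgue T"
      using W_le emeasure_mono[OF \<open>W \<subseteq> T\<close>, of lebesgue] T(1)
      by (simp add: order.trans[OF _ mult_left_mono])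
    also have "emeasure lebesgue T \<le> emeasure lebesgue (E \<union> (T - E))"
      using T E by (intro emeasure_mono) auto
    also have "\<dots> \<le> emeasure lebesgue E + emeasure lebesgue (T - E)"
      using T E by (intro emeasure_subadditive) auto
    also have "\<dots> \<le> emeasure lebesgue E + ennreal e"
      using T(4) by (intro add_left_mono) auto
    finally show ?thesis
      by (simp add: mult_left_mono)
  qed
  define m where "m = measure lebesgue E"
  have m: "emeasure lebesgue E = ennreal m" "0 \<le> m"
    using fin by (auto simp: m_def emeasure_eq_ennreal_measure)
  have le: "q * m \<le> p * m + p * e" if "e > 0" for e
  proof -
    have "ennreal (q * m) \<le> ennreal (p * (m + e))"
      using main[OF that] pq m that by (simp add: ennreal_mult' flip: ennreal_plus)
    then have "q * m \<le> p * (m + e)"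
      using pq m that by (subst (asm) ennreal_le_iff) auto
    then show ?thesis
      by (simp add: distrib_left)
  qed
  have "q * m \<le> p * m + e" if "e > 0" for e
  proof (cases "p = 0")
    case True
    then show ?thesis
      using le[of e] that by simp
  next
    case False
    then show ?thesis
      using le[of "e / p"] pq that by simp
  qed
  then have "q * m \<le> p * m"
    by (rule field_le_epsilon)
  then have "m = 0"
    using pq m(2) by (metis mult_right_mono_neg mult_strict_right_mono not_le order.not_eq_order_implies_strict)
  then show ?thesis
    using E m by (simp add: negligible_iff_null_sets null_setsI)
qed


text \<open>Compactness gives a cluster point \<open>c\<close>. For \<open>a < p < q < c\<close> the
  function cannot stay below \<open>q\<close> eventually, so it eventually stays above
  \<open>p\<close>; levels above \<open>c\<close> are symmetric. Rational thresholds keep the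
  exceptional sets of the application countable in number.\<close>

lemma tendsto_if_no_crossing:
  fixes \<phi> :: "'b::metric_space \<Rightarrow> real"
  assumes bdd: "\<forall>\<^sub>F h in F. \<bar>\<phi> h\<bar> \<le> B" and "F \<noteq> bot"
    and cross: "\<And>p q. p \<in> \<rat> \<Longrightarrow> q \<in> \<rat> \<Longrightarrow> p < q \<Longrightarrow> (\<forall>\<^sub>F h in F. p \<le> \<phi> h) \<or> (\<forall>\<^sub>F h in F. \<phi> h \<le> q)"
  shows "\<exists>c. (\<phi> \<longlongrightarrow> c) F"
proof -
  have "compact {-B..B}"
    by simp
  moreover have "filtermap \<phi> F \<noteq> bot"
    using \<open>F \<noteq> bot\<close> by (simp add: filtermap_bot_iff)
  moreover have "eventually (\<lambda>y. y \<in> {-B..B}) (filtermap \<phi> F)"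
    using bdd by (auto simp: eventually_filtermap abs_le_iff elim!: eventually_mono)
  ultimately obtain c where c: "inf (nhds c) (filtermap \<phi> F) \<noteq> bot"
    unfolding compact_filter by blast
  have near: False if "\<forall>\<^sub>F h in F. \<phi> h \<notin> S" "open S" "c \<in> S" for S
  proof -
    have "eventually (\<lambda>y. y \<in> S) (inf (nhds c) (filtermap \<phi> F))"
      by (rule filter_leD[OF inf_le1]) (use that in \<open>simp add: eventually_nhds_in_open\<close>)
    moreover have "eventually (\<lambda>y. y \<notin> S) (inf (nhds c) (filtermap \<phi> F))"
      by (rule filter_leD[OF inf_le2]) (use that in \<open>simp add: eventually_filtermap\<close>)
    ultimately have "eventually (\<lambda>y. False) (inf (nhds c) (filtermap \<phi> F))"
      by eventually_elim auto
    then show False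
      using c by (simp add: trivial_limit_def)
  qed
  have "(\<phi> \<longlongrightarrow> c) F"
  proof (rule order_tendstoI)
    fix a assume "a < c"
    then obtain p q where "p \<in> \<rat>" "q \<in> \<rat>" "a < p" "p < q" "q < c"
      by (meson Rats_dense_in_real)
    with cross[of p q] near[of "{q<..}"] have "\<forall>\<^sub>F h in F. p \<le> \<phi> h"
      by (auto simp: not_less)
    then show "\<forall>\<^sub>F h in F. a < \<phi> h"
      by eventually_elim (use \<open>a < p\<close> in simp)
  next
    fix a assume "c < a"
    then obtain p q where "p \<in> \<rat>" "q \<in> \<rat>" "c < p" "p < q" "q < a"
      by (meson Rats_dense_in_real)
    with cross[of p q] near[of "{..<p}"] have "\<forall>\<^sub>F h in F. \<phi> h \<le> q"
      by (auto simp: not_less)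
    then show "\<forall>\<^sub>F h in F. \<phi> h < a"
      by eventually_elim (use \<open>q < a\<close> in simp)
  qed
  then show ?thesis
    by blast
qed

text \<open>A difference quotient has \<open>x\<close> as an endpoint of its interval, whereas a
  Vitali cover needs \<open>x\<close> in the interior. As the inequality is strict and
  \<open>F\<close> continuous, the interval can be pushed slightly beyond \<open>x\<close>.\<close>

lemma ball_difference_quotient_less:
  fixes F :: "real \<Rightarrow> real"
  assumes F: "continuous_on UNIV F" and h: "h \<noteq> 0" "(F (x + h) - F x) / h < p"
  shows "\<exists>c r. x \<in> ball c r \<and> r < \<bar>h\<bar> \<and> F (c + r) - F (c - r) < p * (2 * r)"
proof -
  \<comment> \<open>The sign treats both directions at once: the new endpoint is
    \<open>x - s * \<eta>\<close>, on the side of \<open>x\<close> opposite to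
    \<open>x + h\<close>.\<close>
  define s where "s = sgn h"
  have s: "s * s = 1" "h = s * \<bar>h\<bar>" "s = 1 \<or> s = -1"
    using h by (auto simp: s_def sgn_if)
  have "((\<lambda>\<eta>. ((F (x + h) - F (x - s * \<eta>)) - p * (h + s * \<eta>)) * s) \<longlongrightarrow> ((F (x + h) - F (x - s * 0)) - p * (h + s * 0)) * s) (at_right 0)"
    by (intro tendsto_intros continuous_on_tendsto_compose[OF F]) auto
  moreover have "((F (x + h) - F (x - s * 0)) - p * (h + s * 0)) * s < 0"
    using h s(3) by (auto simp: s_def sgn_if field_simps split: if_splits)
  ultimately have "\<forall>\<^sub>F \<eta> in at_right 0. ((F (x + h) - F (x - s * \<eta>)) - p * (h + s * \<eta>)) * s < 0"
    by (rule order_tendstoD)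
  moreover have "\<forall>\<^sub>F \<eta> in at_right 0. 0 < \<eta> \<and> \<eta> < \<bar>h\<bar>"
    using h by (simp add: eventually_at_right_field) (meson zero_less_abs_iff)
  ultimately have "\<forall>\<^sub>F \<eta> in at_right 0. ((F (x + h) - F (x - s * \<eta>)) - p * (h + s * \<eta>)) * s < 0 \<and> 0 < \<eta> \<and> \<eta> < \<bar>h\<bar>"
    by eventually_elim auto
  then obtain \<eta> where \<eta>: "((F (x + h) - F (x - s * \<eta>)) - p * (h + s * \<eta>)) * s < 0" "0 < \<eta>" "\<eta> < \<bar>h\<bar>"
    using eventually_happens'[OF trivial_limit_at_right_real] by (metis (no_types, lifting))
  \<comment> \<open>Midpoint and half length of the interval between \<open>x - s * \<eta>\<close>
    and \<open>x + h\<close>.\<close>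
  define c r where "c = x + (h - s * \<eta>) / 2" and "r = (\<bar>h\<bar> + \<eta>) / 2"
  have "x \<in> ball c r" "r < \<bar>h\<bar>"
    using \<eta> s by (auto simp: c_def r_def dist_real_def)
  moreover have "F (c + r) - F (c - r) < p * (2 * r)"
    using s(3)
  proof
    assume "s = 1"
    then have eq: "h > 0" "c + r = x + h" "c - r = x - \<eta>" "2 * r = h + \<eta>"
      using s(2) h by (auto simp: c_def r_def field_simps)
    show ?thesis
      unfolding eq(2-4) using \<eta>(1) \<open>s = 1\<close> by simp
  next
    assume "s = -1"
    then have eq: "h < 0" "c + r = x + \<eta>" "c - r = x + h" "2 * r = \<eta> - h"
      using s(2) h by (auto simp: c_def r_def field_simps)
    show ?thesis
      unfolding eq(2-4) using \<eta>(1) \<open>s = -1\<close> by (simp add: algebra_simps)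
  qed
  ultimately show ?thesis
    by blast
qed

lemma ball_difference_quotient_greater:
  fixes F :: "real \<Rightarrow> real"
  assumes F: "continuous_on UNIV F" and h: "h \<noteq> 0" "p < (F (x + h) - F x) / h"
  shows "\<exists>c r. x \<in> ball c r \<and> r < \<bar>h\<bar> \<and> p * (2 * r) < F (c + r) - F (c - r)"
proof -
  have "\<exists>c r. x \<in> ball c r \<and> r < \<bar>h\<bar> \<and> (- F (c + r)) - (- F (c - r)) < (- p) * (2 * r)"
  proof (rule ball_difference_quotient_less[of "\<lambda>x. - F x"])
    have "(- F (x + h) - - F x) / h = - ((F (x + h) - F x) / h)"
      by (simp add: diff_divide_distrib)
    then show "(- F (x + h) - - F x) / h < - p"
      using h by linarith
  qed (use assms in \<open>auto intro!: continuous_intros\<close>)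
  then show ?thesis
    by (auto simp: algebra_simps)
qed

text \<open>If the bounded difference quotients at \<open>x\<close> have no limit, two rationals
  \<open>p < q\<close> are crossed by arbitrarily short intervals around \<open>x\<close>. Each such
  pair confines \<open>x\<close> to a set where the two covers above apply.\<close>

lemma mono_lipschitz_differentiable_ae:
  fixes F :: "real \<Rightarrow> real"
  assumes "mono F" and lip: "L-lipschitz_on UNIV F"
  shows "negligible {x. \<not> F differentiable (at x)}"
proof -
  have cont: "continuous_on UNIV F"
    using lip by (rule lipschitz_on_continuous_on)
  \<comment> \<open>As unions of open balls these sets are open, so \<open>E p q m\<close> is Borel
    without any study of upper and lower derivatives. Nonpositive radii contribute empty balls, and
    \<open>m\<close> keeps \<open>E p q m\<close> bounded.\<close>
  define N where "N p n = (\<Union>c. \<Union>r\<in>{r. r < inverse (real (Suc n)) \<and> F (c + r) - F (c - r) < p * (2 * r)}. ball c r)" for p n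
  define P where "P p n = (\<Union>c. \<Union>r\<in>{r. r < inverse (real (Suc n)) \<and> p * (2 * r) < F (c + r) - F (c - r)}. ball c r)" for p n
  define E where "E p q m = (\<Inter>n. N p n \<inter> P q n) \<inter> {- real m .. real m}" for p q m
  have "open (N p n)" "open (P p n)" for p n
    by (auto simp: N_def P_def)
  then have E_borel: "E p q m \<in> sets borel" for p q m
    unfolding E_def by (intro sets.Int sets.countable_INT) auto
  have E_null: "negligible (E p q m)" if "0 \<le> p" "p < q" for p q m
  proof (rule negligible_incompatible_difference_quotients[OF \<open>mono F\<close> cont _ _ that])
    show "E p q m \<in> sets lebesgue"
      using E_borel by simp
    show "bounded (E p q m)"
      by (rule bounded_subset[of "{- real m .. real m}"]) (auto simp: E_def)
    fix x d :: real assume "x \<in> E p q m" "d > 0"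
    moreover obtain n where "inverse (real (Suc n)) < d"
      using reals_Archimedean[OF \<open>d > 0\<close>] by blast
    ultimately have "x \<in> N p n" "x \<in> P q n" "inverse (real (Suc n)) < d"
      by (auto simp: E_def)
    then show "\<exists>c r. x \<in> ball c r \<and> r < d \<and> F (c + r) - F (c - r) \<le> p * (2 * r)"
      and "\<exists>c r. x \<in> ball c r \<and> r < d \<and> q * (2 * r) \<le> F (c + r) - F (c - r)"
      unfolding N_def P_def by (auto, meson less_imp_le less_trans, meson less_imp_le less_trans)
  qed
  have null: "negligible (\<Union>p\<in>\<rat>. \<Union>q\<in>\<rat>. \<Union>m. if 0 \<le> p \<and> p < q then E p q m else {})"
    by (intro negligible_countable_Union countable_image ballI) (auto intro!: negligible_countable_Union E_null countable_rat split: if_splits)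
  show ?thesis
  proof (rule negligible_subset[OF null], intro subsetI, rule ccontr)
    fix x assume "x \<in> {x. \<not> F differentiable (at x)}"
      and x: "x \<notin> (\<Union>p\<in>\<rat>. \<Union>q\<in>\<rat>. \<Union>m. if 0 \<le> p \<and> p < q then E p q m else {})"
    then have "\<not> F differentiable (at x)"
      by simp
    have quot: "0 \<le> (F (x + h) - F x) / h \<and> (F (x + h) - F x) / h \<le> L" if "h \<noteq> 0" for h
    proof
      show "0 \<le> (F (x + h) - F x) / h"
        using monoD[OF \<open>mono F\<close>, of x "x + h"] monoD[OF \<open>mono F\<close>, of "x + h" x] that
        by (cases "h > 0") (auto simp: divide_nonpos_neg)
      have "\<bar>(F (x + h) - F x) / h\<bar> \<le> L"
        using lipschitz_onD[OF lip, of "x + h" x] that by (simp add: dist_real_def field_simps)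
      then show "(F (x + h) - F x) / h \<le> L"
        by linarith
    qed
    have "\<exists>c. ((\<lambda>h. (F (x + h) - F x) / h) \<longlongrightarrow> c) (at 0)"
    proof (rule tendsto_if_no_crossing[where B = L])
      show "\<forall>\<^sub>F h in at 0. \<bar>(F (x + h) - F x) / h\<bar> \<le> L"
        unfolding eventually_at using quot by (metis abs_of_nonneg zero_less_one)
      fix p q :: real assume pq: "p \<in> \<rat>" "q \<in> \<rat>" "p < q"
      show "(\<forall>\<^sub>F h in at 0. p \<le> (F (x + h) - F x) / h) \<or> (\<forall>\<^sub>F h in at 0. (F (x + h) - F x) / h \<le> q)"
      \<comment> \<open>Quotients of a monotone function are nonnegative, so a negative
        \<open>p\<close> is never crossed; the covering estimate is stated for
        \<open>0 \<le> p\<close>.\<close>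
      proof (cases "p < 0")
        case True
        then show ?thesis
          unfolding eventually_at using quot by (meson less_le_trans less_imp_le zero_less_one)
      next
        case False
        obtain m where m: "\<bar>x\<bar> \<le> real m"
          using real_arch_simple by blast
        have "x \<notin> E p q m"
          using x pq False by (auto split: if_splits)
        then obtain n where "x \<notin> N p n \<or> x \<notin> P q n"
          using m by (auto simp: E_def)
        then show ?thesis
        proof
          assume "x \<notin> N p n"
          have "p \<le> (F (x + h) - F x) / h" if "h \<noteq> 0" "\<bar>h\<bar> < inverse (real (Suc n))" for h
          proof (rule ccontr)
            assume "\<not> p \<le> (F (x + h) - F x) / h"
            then obtain c r where "x \<in> ball c r \<and> r < \<bar>h\<bar> \<and> F (c + r) - F (c - r) < p * (2 * r)"
              using ball_difference_quotient_less[OF cont \<open>h \<noteq> 0\<close>, of x p] by (auto simp: not_le)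
            with that(2) have "x \<in> ball c r" "r < inverse (real (Suc n)) \<and> F (c + r) - F (c - r) < p * (2 * r)"
              by linarith+
            then have "x \<in> N p n"
              unfolding N_def by blast
            with \<open>x \<notin> N p n\<close> show False ..
          qed
          then show ?thesis
            unfolding eventually_at by (intro disjI1 exI[of _ "inverse (real (Suc n))"]) (auto simp: dist_real_def)
        next
          assume "x \<notin> P q n"
          have "(F (x + h) - F x) / h \<le> q" if "h \<noteq> 0" "\<bar>h\<bar> < inverse (real (Suc n))" for h
          proof (rule ccontr)
            assume "\<not> (F (x + h) - F x) / h \<le> q"
            then obtain c r where "x \<in> ball c r \<and> r < \<bar>h\<bar> \<and> q * (2 * r) < F (c + r) - F (c - r)"
              using ball_difference_quotient_greater[OF cont \<open>h \<noteq> 0\<close>, of q x] by (auto simp: not_le)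
            with that(2) have "x \<in> ball c r" "r < inverse (real (Suc n)) \<and> q * (2 * r) < F (c + r) - F (c - r)"
              by linarith+
            then have "x \<in> P q n"
              unfolding P_def by blast
            with \<open>x \<notin> P q n\<close> show False ..
          qed
          then show ?thesis
            unfolding eventually_at by (intro disjI2 exI[of _ "inverse (real (Suc n))"]) (auto simp: dist_real_def)
        qed
      qed
    qed auto
    then have "F differentiable (at x)"
      using real_differentiable_def DERIV_def by blast
    with \<open>\<not> F differentiable (at x)\<close> show False ..
  qed
qed

theorem lipschitz_differentiable_ae:
  fixes \<beta> :: "real \<Rightarrow> 'a::euclidean_space"
  assumes lip: "L-lipschitz_on UNIV \<beta>"
  shows "negligible {t. \<not> \<beta> differentiable (at t)}"
proof -
  have "negligible {t. \<not> (\<lambda>t. \<beta> t \<bullet> b) differentiable (at t)}" if "b \<in> Basis" for b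
  proof -
    have b: "\<bar>\<beta> s \<bullet> b - \<beta> t \<bullet> b\<bar> \<le> L * \<bar>s - t\<bar>" for s t
      using Basis_le_norm[OF that, of "\<beta> s - \<beta> t"] lipschitz_onD[OF lip, of s t]
      by (simp add: dist_norm inner_diff_left)
    have "0 \<le> L"
      using lip by (rule lipschitz_on_nonneg)
    \<comment> \<open>The slope \<open>L\<close> of the added linear term outweighs any decrease of
      the coordinate, which makes the sum monotone; it is smooth and can be subtracted
      again.\<close>
    define F where "F t = \<beta> t \<bullet> b + L * t" for t
    have "mono F"
    proof (rule monoI)
      fix s t :: real assume "s \<le> t"
      then show "F s \<le> F t"
        using b[of s t] by (simp add: F_def algebra_simps abs_if split: if_splits)
    qed
    moreover have "(2 * L)-lipschitz_on UNIV F"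
    proof (rule lipschitz_onI)
      fix s t :: real
      have "\<bar>F s - F t\<bar> \<le> \<bar>\<beta> s \<bullet> b - \<beta> t \<bullet> b\<bar> + \<bar>L * (s - t)\<bar>"
        by (simp add: F_def algebra_simps)
      also have "\<dots> \<le> 2 * L * \<bar>s - t\<bar>"
        using b[of s t] \<open>0 \<le> L\<close> by (simp add: abs_mult)
      finally show "dist (F s) (F t) \<le> 2 * L * dist s t"
        by (simp add: dist_real_def)
    qed (use \<open>0 \<le> L\<close> in simp)
    ultimately have "negligible {t. \<not> F differentiable (at t)}"
      by (rule mono_lipschitz_differentiable_ae)
    then show ?thesis
    proof (rule negligible_subset, safe)
      fix t assume "F differentiable (at t)"
      then have "(\<lambda>t. F t - L * t) differentiable (at t)"
        by (intro differentiable_diff differentiable_mult) auto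
      moreover assume "\<not> (\<lambda>t. \<beta> t \<bullet> b) differentiable (at t)"
      ultimately show False
        by (simp add: F_def)
    qed
  qed
  then have "negligible (\<Union>b\<in>Basis. {t. \<not> (\<lambda>t. \<beta> t \<bullet> b) differentiable (at t)})"
    by (intro negligible_Union) auto
  then show ?thesis
    by (rule negligible_subset) (use differentiable_componentwise_within[of \<beta> _ UNIV] in auto)
qed

section \<open>The Clarke subdifferential\<close>

text \<open>Differentiating in the direction \<open>g\<close> itself gives
  \<open>g \<bullet> g \<le> L * norm g\<close>.\<close>

lemma norm_gradient_le_lipschitz:
  fixes f :: "'a::euclidean_space \<Rightarrow> real"
  assumes grad: "GDERIV f y :> g" and lip: "L-lipschitz_on S f" and S: "open S" "y \<in> S"
  shows "norm g \<le> L"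
proof -
  have "((\<lambda>t. f (y + t *\<^sub>R g)) has_derivative (\<lambda>t. (t *\<^sub>R g) \<bullet> g)) (at 0)"
  proof (rule has_derivative_compose[where g = f])
    show "((\<lambda>t. y + t *\<^sub>R g) has_derivative (\<lambda>t. t *\<^sub>R g)) (at 0)"
      by (auto intro!: derivative_eq_intros)
  qed (use grad in \<open>simp add: gderiv_def\<close>)
  then have "((\<lambda>t. f (y + t *\<^sub>R g)) has_field_derivative g \<bullet> g) (at 0)"
    by (rule has_derivative_imp_has_field_derivative) (simp add: mult.commute)
  then have lim: "((\<lambda>t. (f (y + t *\<^sub>R g) - f y) / t) \<longlongrightarrow> g \<bullet> g) (at 0)"
    by (simp add: DERIV_def)
  have "((\<lambda>t. y + t *\<^sub>R g) \<longlongrightarrow> y + 0 *\<^sub>R g) (at 0)"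
    by (intro tendsto_intros)
  then have "\<forall>\<^sub>F t in at 0. y + t *\<^sub>R g \<in> S"
    using S by (auto dest: topological_tendstoD)
  moreover have "\<forall>\<^sub>F t in at 0. t \<noteq> (0::real)"
    by (simp add: eventually_at_filter)
  ultimately have "\<forall>\<^sub>F t in at 0. (f (y + t *\<^sub>R g) - f y) / t \<le> L * norm g"
  proof eventually_elim
    case (elim t)
    have "\<bar>f (y + t *\<^sub>R g) - f y\<bar> \<le> L * (\<bar>t\<bar> * norm g)"
      using lipschitz_onD[OF lip elim(1) S(2)] by (simp add: dist_norm)
    then have "\<bar>(f (y + t *\<^sub>R g) - f y) / t\<bar> \<le> L * norm g"
      using elim(2) by (simp add: field_simps)
    then show ?case
      by linarith
  qed
  then have "g \<bullet> g \<le> L * norm g"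
    by (rule tendsto_upperbound[OF lim]) simp
  then have "norm g * norm g \<le> L * norm g"
    by (simp add: dot_square_norm power2_eq_square)
  moreover have "0 \<le> L"
    using lip by (rule lipschitz_on_nonneg)
  ultimately show ?thesis
    by (cases "g = 0") auto
qed

text \<open>The Bouligand subdifferential. Closedness of the graph and local bounds are proved for
  it directly and then carried over to its closed convex hull.\<close>

definition limiting_gradients :: "('a::euclidean_space \<Rightarrow> real) \<Rightarrow> 'a \<Rightarrow> 'a set" where
  "limiting_gradients f x =
     {v. \<exists>y g. y \<longlonglongrightarrow> x \<and> (\<forall>k::nat. GDERIV f (y k) :> g k) \<and> g \<longlonglongrightarrow> v}"

lemma clarke_subdiff_eq: "clarke_subdiff f x = closure (convex hull (limiting_gradients f x))"
  by (simp add: clarke_subdiff_def limiting_gradients_def)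

lemma closed_clarke_subdiff: "closed (clarke_subdiff f x)"
  and convex_clarke_subdiff: "convex (clarke_subdiff f x)"
  by (simp_all add: clarke_subdiff_eq convex_closure)

text \<open>The device that carries a bound from limiting gradients to the hull: \<open>S\<close>
  will be a closed ball or a closed half-space.\<close>

lemma clarke_subdiff_minimal:
  assumes "limiting_gradients f x \<subseteq> S" "closed S" "convex S"
  shows "clarke_subdiff f x \<subseteq> S"
  using assms by (simp add: clarke_subdiff_eq closure_minimal hull_minimal)

lemma limiting_gradients_subset_clarke: "limiting_gradients f x \<subseteq> clarke_subdiff f x"
  unfolding clarke_subdiff_eq using closure_subset hull_subset by (metis order.trans)

lemma limiting_gradients_locally_bounded:
  assumes "locally_Lipschitz f"
  shows "\<exists>u>0. \<exists>L. \<forall>y\<in>ball x u. \<forall>v\<in>limiting_gradients f y. norm v \<le> L"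
proof -
  obtain u L where u: "u > 0" "L-lipschitz_on (cball x u) f"
    using assms unfolding locally_Lipschitz_def by blast
  have lip: "L-lipschitz_on (ball x u) f"
    by (rule lipschitz_on_subset[OF u(2)]) auto
  have "norm v \<le> L" if y: "y \<in> ball x u" and v: "v \<in> limiting_gradients f y" for y v
  proof -
    obtain z g where zg: "z \<longlonglongrightarrow> y" "\<And>k::nat. GDERIV f (z k) :> g k" "g \<longlonglongrightarrow> v"
      using v unfolding limiting_gradients_def by blast
    have "\<forall>\<^sub>F k in sequentially. z k \<in> ball x u"
      using zg(1) y by (metis open_ball topological_tendstoD)
    then have "\<forall>\<^sub>F k in sequentially. norm (g k) \<le> L"
      by eventually_elim (use norm_gradient_le_lipschitz[OF zg(2) lip] in auto)
    then show ?thesis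
      by (rule tendsto_upperbound[OF tendsto_norm[OF zg(3)]]) simp
  qed
  then show ?thesis
    using u(1) by blast
qed

lemma clarke_subdiff_locally_bounded:
  assumes "locally_Lipschitz f"
  shows "\<exists>u>0. \<exists>L. \<forall>y\<in>ball x u. \<forall>v\<in>clarke_subdiff f y. norm v \<le> L"
proof -
  obtain u L where u: "u > 0" "\<forall>y\<in>ball x u. \<forall>v\<in>limiting_gradients f y. norm v \<le> L"
    using limiting_gradients_locally_bounded[OF assms] by blast
  have "clarke_subdiff f y \<subseteq> cball 0 L" if "y \<in> ball x u" for y
    by (rule clarke_subdiff_minimal) (use u that in auto)
  then show ?thesis
    using u(1) by (metis mem_cball_0 subsetD)
qed

text \<open>Otherwise there are points with subgradients of norm above every \<open>n\<close>; along
  a convergent subsequence they contradict the local bound at the limit point.\<close>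

lemma clarke_subdiff_bounded_on_bounded:
  assumes "locally_Lipschitz f" "bounded S"
  shows "\<exists>M. \<forall>y\<in>S. \<forall>v\<in>clarke_subdiff f y. norm v \<le> M"
proof (rule ccontr)
  assume "\<nexists>M. \<forall>y\<in>S. \<forall>v\<in>clarke_subdiff f y. norm v \<le> M"
  then have "\<forall>n::nat. \<exists>y v. y \<in> S \<and> v \<in> clarke_subdiff f y \<and> real n < norm v"
    by (meson not_le)
  then obtain y v where yv: "\<And>n. y n \<in> S" "\<And>n. v n \<in> clarke_subdiff f (y n)" "\<And>n::nat. real n < norm (v n)"
    by metis
  have "bounded (range y)"
    by (rule bounded_subset[OF assms(2)]) (use yv in auto)
  then obtain l r where lr: "strict_mono (r :: nat \<Rightarrow> nat)" "(y \<circ> r) \<longlonglongrightarrow> l"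
    using bounded_imp_convergent_subsequence by blast
  obtain u L where u: "u > 0" "\<forall>y\<in>ball l u. \<forall>v\<in>clarke_subdiff f y. norm v \<le> L"
    using clarke_subdiff_locally_bounded[OF assms(1)] by blast
  have "\<forall>\<^sub>F n in sequentially. (y \<circ> r) n \<in> ball l u"
    using lr(2) u(1) by (metis centre_in_ball open_ball topological_tendstoD)
  moreover have "\<forall>\<^sub>F n in sequentially. L \<le> real n"
    by (metis eventually_sequentiallyI nat_ceiling_le_eq)
  ultimately have "\<forall>\<^sub>F n in sequentially. False"
  proof eventually_elim
    case (elim n)
    then have "norm (v (r n)) \<le> L"
      using u(2) yv(2) by auto
    moreover have "real n \<le> real (r n)"
      using lr(1) by (simp add: seq_suble)
    ultimately show ?case
      using yv(3)[of "r n"] elim(2) by linarith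
  qed
  then show False
    by simp
qed

text \<open>A diagonal choice: for each \<open>n\<close> one differentiability point within
  \<open>1 / (n + 1)\<close> of \<open>y n\<close> whose gradient is as close to
  \<open>v n\<close>.\<close>

lemma limiting_gradients_closed_graph:
  assumes y: "y \<longlonglongrightarrow> x" and v: "v \<longlonglongrightarrow> w" and "\<And>n::nat. v n \<in> limiting_gradients f (y n)"
  shows "w \<in> limiting_gradients f x"
proof -
  have "\<exists>z g. GDERIV f z :> g \<and> dist z (y n) < inverse (real (Suc n)) \<and> dist g (v n) < inverse (real (Suc n))" for n
  proof -
    obtain z g where zg: "z \<longlonglongrightarrow> y n" "\<And>k::nat. GDERIV f (z k) :> g k" "g \<longlonglongrightarrow> v n"
      using assms(3)[of n] unfolding limiting_gradients_def by blast
    have "\<forall>\<^sub>F k in sequentially. dist (z k) (y n) < inverse (real (Suc n))"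
      "\<forall>\<^sub>F k in sequentially. dist (g k) (v n) < inverse (real (Suc n))"
      using zg(1,3) by (auto intro: tendstoD)
    then have "\<forall>\<^sub>F k in sequentially. dist (z k) (y n) < inverse (real (Suc n)) \<and> dist (g k) (v n) < inverse (real (Suc n))"
      by eventually_elim auto
    then show ?thesis
      using zg(2) by (auto dest!: eventually_happens)
  qed
  then obtain z g where zg: "\<And>n. GDERIV f (z n) :> g n"
    "\<And>n. dist (z n) (y n) < inverse (real (Suc n))" "\<And>n. dist (g n) (v n) < inverse (real (Suc n))"
    by metis
  have "(\<lambda>n. z n - y n) \<longlonglongrightarrow> 0" "(\<lambda>n. g n - v n) \<longlonglongrightarrow> 0"
    using zg(2,3) unfolding dist_norm
    by (auto intro!: Lim_null_comparison[OF _ LIMSEQ_inverse_real_of_nat] always_eventually less_imp_le)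
  from this(1)[THEN tendsto_add, OF y] this(2)[THEN tendsto_add, OF v]
  have "z \<longlonglongrightarrow> x" "g \<longlonglongrightarrow> w"
    by simp_all
  then show ?thesis
    using zg(1) unfolding limiting_gradients_def by blast
qed

text \<open>Separating a limit velocity outside the Clarke subdifferential by a half-space reduces the
  closedness of the graph of the convexified map to that of the limiting gradients.\<close>

lemma clarke_subdiff_closed_graph:
  assumes f: "locally_Lipschitz f"
    and y: "y \<longlonglongrightarrow> x" and v: "v \<longlonglongrightarrow> w" and vy: "\<And>n::nat. v n \<in> clarke_subdiff f (y n)"
  shows "w \<in> clarke_subdiff f x"
proof (rule ccontr)
  assume "w \<notin> clarke_subdiff f x"
  then obtain a b where ab: "a \<bullet> w < b" "\<And>u. u \<in> clarke_subdiff f x \<Longrightarrow> b < a \<bullet> u"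
    using separating_hyperplane_closed_point[OF convex_clarke_subdiff closed_clarke_subdiff] by blast
  \<comment> \<open>Were this false, limiting gradients \<open>u\<close> with
    \<open>a \<bullet> u < b\<close> would occur at points tending to \<open>x\<close>. By local
    boundedness they accumulate at a limiting gradient \<open>l\<close> of \<open>x\<close> with
    \<open>a \<bullet> l \<le> b\<close>, against the separation.\<close>
  have "\<forall>\<^sub>F n in sequentially. \<forall>u\<in>limiting_gradients f (y n). b \<le> a \<bullet> u"
  proof (rule ccontr)
    assume neg: "\<not> ?thesis"
    obtain \<delta> L where L: "\<delta> > 0" "\<forall>y\<in>ball x \<delta>. \<forall>v\<in>limiting_gradients f y. norm v \<le> L"
      using limiting_gradients_locally_bounded[OF f] by blast
    have "\<forall>\<^sub>F n in sequentially. y n \<in> ball x \<delta>"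
      using y L(1) by (metis centre_in_ball open_ball topological_tendstoD)
    then obtain N0 where N0: "\<And>n. n \<ge> N0 \<Longrightarrow> y n \<in> ball x \<delta>"
      unfolding eventually_sequentially by blast
    have "\<exists>n u. n \<ge> max N N0 \<and> u \<in> limiting_gradients f (y n) \<and> a \<bullet> u < b" for N
      using neg unfolding eventually_sequentially by (meson not_le)
    then obtain m u where mu: "\<And>N. m N \<ge> max N N0" "\<And>N. u N \<in> limiting_gradients f (y (m N))" "\<And>N. a \<bullet> u N < b"
      by metis
    have "bounded (range u)"
      unfolding bounded_iff using L(2) N0 mu by (metis (no_types, lifting) imageE max.bounded_iff)
    then obtain l r where lr: "strict_mono (r :: nat \<Rightarrow> nat)" "(u \<circ> r) \<longlonglongrightarrow> l"
      using bounded_imp_convergent_subsequence by blast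
    have "filterlim m at_top sequentially"
      by (rule filterlim_at_top_mono[OF filterlim_ident]) (use mu(1) in auto)
    then have "filterlim (m \<circ> r) at_top sequentially"
      unfolding comp_def using filterlim_compose filterlim_subseq[OF lr(1)] by blast
    then have "(\<lambda>N. y ((m \<circ> r) N)) \<longlonglongrightarrow> x"
      using filterlim_compose[OF y] by blast
    then have "l \<in> limiting_gradients f x"
      by (rule limiting_gradients_closed_graph[OF _ lr(2)]) (use mu(2) in auto)
    then have "b < a \<bullet> l"
      using ab(2) limiting_gradients_subset_clarke by blast
    moreover have "a \<bullet> l \<le> b"
      by (rule LIMSEQ_le_const2[OF tendsto_inner[OF tendsto_const lr(2)]]) (use mu(3) less_imp_le in auto)
    ultimately show False
      by simp
  qed
  then have "\<forall>\<^sub>F n in sequentially. b \<le> a \<bullet> v n"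
  proof eventually_elim
    case (elim n)
    have "clarke_subdiff f (y n) \<subseteq> {u. b \<le> a \<bullet> u}"
      by (rule clarke_subdiff_minimal) (use elim in \<open>auto simp: closed_halfspace_ge convex_halfspace_ge\<close>)
    then show ?case
      using vy by blast
  qed
  then have "b \<le> a \<bullet> w"
    by (rule tendsto_lowerbound[OF tendsto_inner[OF tendsto_const v]]) simp
  with ab(1) show False
    by simp
qed

lemma closed_neg_clarke_graph:
  assumes "locally_Lipschitz f"
  shows "closed {(x, v). - v \<in> clarke_subdiff f x}"
  unfolding closed_sequential_limits
proof (intro allI impI, elim conjE)
  fix z :: "nat \<Rightarrow> 'a \<times> 'a" and l
  assume z: "\<forall>n. z n \<in> {(x, v). - v \<in> clarke_subdiff f x}" "z \<longlonglongrightarrow> l"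
  have "- snd l \<in> clarke_subdiff f (fst l)"
    by (rule clarke_subdiff_closed_graph[OF assms tendsto_fst[OF z(2)] tendsto_minus[OF tendsto_snd[OF z(2)]]])
       (use z(1) in \<open>auto simp: case_prod_unfold\<close>)
  then show "l \<in> {(x, v). - v \<in> clarke_subdiff f x}"
    by (simp add: case_prod_unfold)
qed

text \<open>A separating functional \<open>a\<close> commutes with the expectation, so the bound
  \<open>b < a \<bullet> X \<omega>\<close> valid almost surely passes, weakened to
  \<open>\<le>\<close>, to the mean.\<close>

lemma (in prob_space) expectation_mem_closed_convex:
  fixes X :: "'a \<Rightarrow> 'b::euclidean_space"
  assumes "integrable M X" "AE \<omega> in M. X \<omega> \<in> S" "closed S" "convex S"
  shows "expectation X \<in> S"
proof (rule ccontr)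
  assume "expectation X \<notin> S"
  then obtain a b where ab: "a \<bullet> expectation X < b" "\<And>u. u \<in> S \<Longrightarrow> b < a \<bullet> u"
    using separating_hyperplane_closed_point[OF assms(4,3)] by blast
  have "b = expectation (\<lambda>_. b)"
    by (simp add: prob_space)
  also have "\<dots> \<le> expectation (\<lambda>\<omega>. a \<bullet> X \<omega>)"
    using assms(1,2) ab(2) by (intro integral_mono_AE) (auto intro: less_imp_le)
  also have "\<dots> = a \<bullet> expectation X"
    using assms(1) by simp
  finally show False
    using ab(1) by simp
qed

section \<open>The interpolating curve\<close>

locale subgradient_curve =
  fixes f :: "'a::euclidean_space \<Rightarrow> real"
    and \<epsilon> :: "nat \<Rightarrow> real" and x v :: "nat \<Rightarrow> 'a" and \<gamma> :: "real \<Rightarrow> 'a"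
  assumes lip: "locally_Lipschitz f"
    and steps: "step_sizes \<epsilon>"
    and subgradients: "subgradient_sequence f \<epsilon> x v"
    and bounded_iterates: "bounded (range x)"
    and interpolating: "interpolating_curve \<epsilon> x v \<gamma>"
begin

abbreviation node :: "nat \<Rightarrow> real" where "node \<equiv> node_time \<epsilon>"

text \<open>The minimum exists because the node times tend to infinity. For \<open>0 \<le> t\<close>
  it singles out the half-open step interval containing \<open>t\<close>; for negative
  \<open>t\<close> it is 0.\<close>

definition idx :: "real \<Rightarrow> nat" where "idx t = (LEAST i. t < node (Suc i))"

text \<open>A Borel measurable function with a definite value at the nodes as well; it stands in for
  the derivative of \<open>\<gamma>\<close>, from which it can differ on \<open>{0..}\<close> only
  at the countably many nodes.\<close>

definition velocity :: "real \<Rightarrow> 'a" where "velocity t = - v (idx t)"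

lemma node_Suc: "node (Suc i) = node i + \<epsilon> i"
  by (simp add: node_time_def)

lemma node_0: "node 0 = 0"
  by (simp add: node_time_def)

lemma \<epsilon>_pos: "0 < \<epsilon> i"
  using steps by (simp add: step_sizes_def)

lemma mono_node: "mono node"
  by (rule mono_iff_le_Suc[THEN iffD2]) (simp add: node_Suc \<epsilon>_pos less_imp_le)

lemma filterlim_node: "filterlim node at_top sequentially"
  using steps by (simp add: step_sizes_def node_time_def[abs_def])

lemma idx_upper: "t < node (Suc (idx t))"
proof -
  obtain n where "t < node n"
    using filterlim_node unfolding filterlim_at_top_dense by (meson eventually_happens trivial_limit_sequentially)
  also have "node n \<le> node (Suc n)"
    by (simp add: node_Suc \<epsilon>_pos less_imp_le)
  finally show ?thesis
    unfolding idx_def by (rule LeastI)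
qed

lemma idx_lower:
  assumes "0 \<le> t"
  shows "node (idx t) \<le> t"
proof (cases "idx t")
  case (Suc i)
  then have "\<not> t < node (Suc i)"
    using not_less_Least[of i "\<lambda>i. t < node (Suc i)"] unfolding idx_def by simp
  then show ?thesis
    using Suc by simp
qed (use assms in \<open>simp add: node_0\<close>)

lemma idx_ge:
  assumes "node n \<le> t"
  shows "n \<le> idx t"
proof (rule ccontr)
  assume "\<not> n \<le> idx t"
  then have "node (Suc (idx t)) \<le> node n"
    using mono_node by (simp add: monoD)
  then show False
    using idx_upper[of t] assms by simp
qed

lemma continuous_\<gamma>: "continuous_on {0..} \<gamma>"
  using interpolating by (simp add: interpolating_curve_def)

lemma \<gamma>_has_velocity:
  assumes "0 \<le> t" "t \<notin> range node"
  shows "(\<gamma> has_vector_derivative velocity t) (at t)"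
proof -
  have "node (idx t) < t"
    using idx_lower[OF assms(1)] assms(2) by (metis less_eq_real_def rangeI)
  then show ?thesis
    using interpolating idx_upper[of t] by (auto simp: interpolating_curve_def velocity_def)
qed

lemma \<gamma>_eq:
  assumes "0 \<le> t"
  shows "\<gamma> t = x (idx t) + (t - node (idx t)) *\<^sub>R velocity t"
proof -
  let ?i = "idx t"
  have le: "node ?i \<le> t"
    using idx_lower[OF assms] .
  have "0 \<le> node ?i"
    using mono_node node_0 by (metis monoD zero_le)
  have "((\<lambda>_. velocity t) has_integral (\<gamma> t - \<gamma> (node ?i))) {node ?i..t}"
  proof (rule fundamental_theorem_of_calculus_interior[OF le])
    show "continuous_on {node ?i..t} \<gamma>"
      by (rule continuous_on_subset[OF continuous_\<gamma>]) (use \<open>0 \<le> node ?i\<close> in auto)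
    fix s assume "s \<in> {node ?i<..<t}"
    then show "(\<gamma> has_vector_derivative velocity t) (at s)"
      using interpolating idx_upper[of t] by (auto simp: interpolating_curve_def velocity_def)
  qed
  moreover have "((\<lambda>_. velocity t) has_integral (t - node ?i) *\<^sub>R velocity t) {node ?i..t}"
    using has_integral_const_real[of "velocity t" "node ?i" t] le by simp
  ultimately have "\<gamma> t - \<gamma> (node ?i) = (t - node ?i) *\<^sub>R velocity t"
    by (rule has_integral_unique)
  then show ?thesis
    using interpolating by (simp add: interpolating_curve_def algebra_simps)
qed

lemma v_mem: "v i \<in> clarke_subdiff f (x i)"
  using subgradients by (simp add: subgradient_sequence_def)

lemma bounded_v: "\<exists>M\<ge>0. \<forall>i. norm (v i) \<le> M"
proof -
  obtain M where "\<forall>y\<in>range x. \<forall>u\<in>clarke_subdiff f y. norm u \<le> M"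
    using clarke_subdiff_bounded_on_bounded[OF lip bounded_iterates] by blast
  then have "\<forall>i. norm (v i) \<le> max M 0"
    using v_mem by (metis max.coboundedI1 rangeI)
  then show ?thesis
    by (meson max.cobounded2)
qed

lemma dist_\<gamma>_iterate:
  assumes "\<forall>i. norm (v i) \<le> M" "0 \<le> t"
  shows "dist (\<gamma> t) (x (idx t)) \<le> \<epsilon> (idx t) * M"
proof -
  have "\<bar>t - node (idx t)\<bar> \<le> \<epsilon> (idx t)"
    using idx_lower[OF assms(2)] idx_upper[of t] by (simp add: node_Suc)
  then have "\<bar>t - node (idx t)\<bar> * norm (velocity t) \<le> \<epsilon> (idx t) * M"
    using assms(1) by (intro mult_mono) (auto simp: velocity_def \<epsilon>_pos less_imp_le)
  then show ?thesis
    using \<gamma>_eq[OF assms(2)] by (simp add: dist_norm)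
qed

lemma bounded_phase_curve:
  "\<exists>K. compact K \<and> (\<forall>t\<ge>0. (\<gamma> t, velocity t) \<in> K)"
proof -
  obtain M where M: "0 \<le> M" "\<forall>i. norm (v i) \<le> M"
    using bounded_v by blast
  obtain R where R: "\<And>i. norm (x i) \<le> R"
    using bounded_iterates unfolding bounded_iff by auto
  have "norm (\<gamma> t) \<le> R + \<epsilon> 0 * M" if "0 \<le> t" for t
  proof -
    have "\<epsilon> (idx t) \<le> \<epsilon> 0"
      using steps by (auto simp: step_sizes_def decseq_def)
    then have "dist (\<gamma> t) (x (idx t)) \<le> \<epsilon> 0 * M"
      using dist_\<gamma>_iterate[OF M(2) that] mult_right_mono[OF _ M(1)] by (meson order.trans)
    moreover have "norm (\<gamma> t) \<le> norm (x (idx t)) + dist (\<gamma> t) (x (idx t))"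
      by (metis dist_norm norm_triangle_sub)
    ultimately show ?thesis
      using R[of "idx t"] by linarith
  qed
  then show ?thesis
    using M(2) by (intro exI[of _ "cball 0 (R + \<epsilon> 0 * M) \<times> cball 0 M"]) (auto simp: compact_Times velocity_def)
qed

text \<open>The graph point \<open>(x i, - v i)\<close> shares its second component with the moving
  point, so only the distance of \<open>\<gamma> t\<close> to the iterate counts, at most
  \<open>\<epsilon> i * M\<close>.\<close>

lemma infdist_phase_curve_neg_clarke_graph:
  assumes "0 < \<delta>"
  shows "\<exists>T\<ge>0. \<forall>t\<ge>T. infdist (\<gamma> t, velocity t) {(x, v). - v \<in> clarke_subdiff f x} \<le> \<delta>"
proof -
  obtain M where M: "0 \<le> M" "\<forall>i. norm (v i) \<le> M"
    using bounded_v by blast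
  have "(\<lambda>i. \<epsilon> i * M) \<longlonglongrightarrow> 0 * M"
    using steps by (intro tendsto_intros) (simp add: step_sizes_def)
  then have "\<forall>\<^sub>F i in sequentially. \<epsilon> i * M < \<delta>"
    using assms by (intro order_tendstoD(2)[of _ 0]) simp_all
  then obtain N where N: "\<And>i. i \<ge> N \<Longrightarrow> \<epsilon> i * M < \<delta>"
    unfolding eventually_sequentially by blast
  have "infdist (\<gamma> t, velocity t) {(x, v). - v \<in> clarke_subdiff f x} \<le> \<delta>" if "node N \<le> t" for t
  proof -
    have "0 \<le> node N"
      using mono_node node_0 by (metis monoD zero_le)
    then have "dist (\<gamma> t) (x (idx t)) \<le> \<delta>"
      using dist_\<gamma>_iterate[OF M(2), of t] N[OF idx_ge[OF that]] that by linarith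
    moreover have "infdist (\<gamma> t, velocity t) {(x, v). - v \<in> clarke_subdiff f x} \<le> dist (\<gamma> t, velocity t) (x (idx t), velocity t)"
      using v_mem by (intro infdist_le) (simp add: velocity_def)
    ultimately show ?thesis
      by (simp add: dist_Pair_Pair)
  qed
  moreover have "0 \<le> node N"
    using mono_node node_0 by (metis monoD zero_le)
  ultimately show ?thesis
    by blast
qed

lemma measurable_velocity [measurable]: "velocity \<in> borel_measurable borel"
proof -
  have "idx \<in> borel \<rightarrow>\<^sub>M count_space UNIV"
    unfolding idx_def[abs_def] by measurable
  then show ?thesis
    unfolding velocity_def[abs_def] by (rule measurable_compose) simp
qed

lemma measurable_phase_curve:
  assumes "B \<in> sets lebesgue" "B \<subseteq> {0..}"
  shows "(\<lambda>t. (\<gamma> t, velocity t)) \<in> borel_measurable (lebesgue_on B)"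
proof (rule borel_measurable_Pair)
  show "\<gamma> \<in> borel_measurable (lebesgue_on B)"
    by (rule continuous_imp_measurable_on_sets_lebesgue[OF continuous_on_subset[OF continuous_\<gamma> assms(2)] assms(1)])
  show "velocity \<in> borel_measurable (lebesgue_on B)"
    by (intro measurable_restrict_space1 measurable_completion) simp
qed

text \<open>Replacing the derivative by \<open>velocity\<close> changes the integrand on a countable
  set of nodes only, which is null; the uniform measure has density \<open>1 / |B|\<close> on
  \<open>B\<close>.\<close>

lemma integral_curve_measure:
  fixes \<phi> :: "'a \<times> 'a \<Rightarrow> real"
  assumes B: "B \<in> sets lebesgue" "B \<subseteq> {0..}" "emeasure lebesgue B \<noteq> 0" "emeasure lebesgue B \<noteq> \<infinity>"
    and \<phi>: "\<phi> \<in> borel_measurable borel"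
  shows "(LINT z|curve_measure \<gamma> B. \<phi> z) =
    (LINT t|lebesgue_on B. \<phi> (\<gamma> t, velocity t)) / measure lebesgue B"
proof -
  let ?w = "\<lambda>t. vector_derivative \<gamma> (at t)"
  let ?X = "range node \<inter> B"
  have X: "countable ?X"
    by simp
  have X_sets: "{t} \<in> sets (lebesgue_on B)" if "t \<in> ?X" for t
    using that B(1) by (auto simp: sets_restrict_space image_iff intro!: bexI[of _ "{t}"])
  have X_null: "emeasure (lebesgue_on B) {t} = 0" if "t \<in> ?X" for t
    using that B(1) by (subst emeasure_restrict_space) auto
  have eq: "(\<gamma> t, velocity t) = (\<gamma> t, ?w t)" if "t \<in> space (lebesgue_on B)" "t \<notin> ?X" for t
    using that B(2) \<gamma>_has_velocity[of t] by (auto simp: space_restrict_space intro!: vector_derivative_at[symmetric])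
  have meas: "(\<lambda>t. (\<gamma> t, ?w t)) \<in> borel_measurable (lebesgue_on B)"
    by (rule measurable_discrete_difference[OF measurable_phase_curve[OF B(1,2)] X X_sets _ eq]) auto
  then have meas': "(\<lambda>t. (\<gamma> t, ?w t)) \<in> borel_measurable (uniform_measure (lebesgue_on B) B)"
    by (simp add: uniform_measure_def)
  have em: "emeasure (lebesgue_on B) B = emeasure lebesgue B"
    using B(1) by (subst emeasure_restrict_space) auto
  define m where "m = measure lebesgue B"
  have m: "emeasure lebesgue B = ennreal m" "0 < m"
    using B(3,4) by (auto simp: m_def emeasure_eq_ennreal_measure measure_nonneg less_eq_real_def top.not_eq_extremum zero_less_measure_iff)
  have meas_\<phi>: "(\<lambda>t. \<phi> (\<gamma> t, ?w t)) \<in> borel_measurable (lebesgue_on B)"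
    using measurable_compose[OF meas \<phi>] .
  have dens: "uniform_measure (lebesgue_on B) B = density (lebesgue_on B) (\<lambda>t. ennreal (indicator B t / m))"
    unfolding uniform_measure_def em m(1) using m(2)
    by (intro arg_cong2[where f = density] ext) (auto simp: indicator_def divide_ennreal simp flip: ennreal_1)
  have "(LINT z|curve_measure \<gamma> B. \<phi> z) = (LINT t|uniform_measure (lebesgue_on B) B. \<phi> (\<gamma> t, ?w t))"
    unfolding curve_measure_def by (rule integral_distr[OF meas' \<phi>])
  also have "\<dots> = (LINT t|lebesgue_on B. (indicator B t / m) *\<^sub>R \<phi> (\<gamma> t, ?w t))"
    unfolding dens using meas_\<phi> m(2) B(1)
    by (intro integral_density) (auto intro!: borel_measurable_divide borel_measurable_indicator simp: sets_restrict_space)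
  also have "\<dots> = (LINT t|lebesgue_on B. \<phi> (\<gamma> t, ?w t) / m)"
    by (rule Bochner_Integration.integral_cong) (auto simp: space_restrict_space)
  also have "\<dots> = (LINT t|lebesgue_on B. \<phi> (\<gamma> t, ?w t)) / m"
    by simp
  also have "(LINT t|lebesgue_on B. \<phi> (\<gamma> t, ?w t)) = (LINT t|lebesgue_on B. \<phi> (\<gamma> t, velocity t))"
    by (rule integral_discrete_difference[OF X X_null X_sets]) (auto simp: eq)
  finally show "(LINT z|curve_measure \<gamma> B. \<phi> z) = (LINT t|lebesgue_on B. \<phi> (\<gamma> t, velocity t)) / measure lebesgue B"
    by (simp add: m_def)
qed

end

section \<open>Time averages of continuous functions and gradients along the curve\<close>

lemma smooth_fun_continuous_gradient:
  fixes g :: "'a::euclidean_space \<Rightarrow> real"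
  assumes "smooth_fun g" "\<And>x. GDERIV g x :> Dg x"
  shows "continuous_on UNIV Dg"
proof -
  have "continuous_on UNIV (\<lambda>x. Dg x \<bullet> b)" if b: "b \<in> Basis" for b
  proof -
    have "Ck_fun (Suc 0) g"
      using assms(1) by (simp only: smooth_fun_def)
    then have "continuous_on UNIV (\<lambda>x. frechet_derivative g (at x) b)"
      using b by simp
    moreover have "frechet_derivative g (at x) b = Dg x \<bullet> b" for x
    proof -
      have "(\<lambda>h. h \<bullet> Dg x) = frechet_derivative g (at x)"
        using assms(2)[of x] by (intro frechet_derivative_at) (simp add: gderiv_def)
      from fun_cong[OF this, of b] show ?thesis
        by (simp add: inner_commute)
    qed
    ultimately show ?thesis
      by simp
  qed
  then have "continuous_on UNIV (\<lambda>x. \<Sum>b\<in>Basis. (Dg x \<bullet> b) *\<^sub>R b)"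
    by (intro continuous_on_sum continuous_on_scaleR continuous_on_const)
  then show ?thesis
    by (simp add: euclidean_representation)
qed

lemma continuous_on_gradient_pairing:
  fixes Dg :: "'a::euclidean_space \<Rightarrow> 'a"
  assumes "continuous_on UNIV Dg"
  shows "continuous_on UNIV (\<lambda>z. Dg (fst z) \<bullet> snd z)"
  by (intro continuous_on_inner continuous_on_compose2[OF assms] continuous_on_fst continuous_on_snd continuous_on_id) auto

text \<open>Beyond some \<open>N\<close> each term is at least \<open>2 * c\<close>, and for
  \<open>2 * N \<le> K\<close> at least half of the \<open>K\<close> terms lie beyond
  \<open>N\<close>.\<close>

lemma partial_sums_superlinear:
  fixes a :: "nat \<Rightarrow> real" and k :: "nat \<Rightarrow> nat"
  assumes "\<And>j. 0 \<le> a j" "filterlim a at_top sequentially" "filterlim k at_top F" and "0 \<le> c"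
  shows "\<forall>\<^sub>F n in F. c * real (k n) \<le> (\<Sum>j=1..k n. a j)"
proof -
  have "\<forall>\<^sub>F j in sequentially. 2 * c \<le> a j"
    using assms(2) by (simp add: filterlim_at_top)
  then obtain N where N: "\<And>j. j \<ge> N \<Longrightarrow> 2 * c \<le> a j"
    unfolding eventually_sequentially by blast
  have "c * real K \<le> (\<Sum>j=1..K. a j)" if "2 * N \<le> K" for K
  proof -
    have "c * real K \<le> 2 * c * real (K - N)"
      using that mult_left_mono[of "real K" "2 * real (K - N)" c] \<open>0 \<le> c\<close> by (simp add: of_nat_diff algebra_simps)
    also have "\<dots> = (\<Sum>j=N+1..K. 2 * c)"
      by simp
    also have "\<dots> \<le> (\<Sum>j=N+1..K. a j)"
      by (rule sum_mono) (use N in auto)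
    also have "\<dots> \<le> (\<Sum>j=1..K. a j)"
      by (rule sum_mono2) (use assms(1) in auto)
    finally show ?thesis .
  qed
  moreover have "\<forall>\<^sub>F n in F. 2 * N \<le> k n"
    using assms(3) by (simp add: filterlim_at_top)
  ultimately show ?thesis
    by (auto elim: eventually_mono)
qed

context subgradient_curve
begin

lemma integrable_phase_curve:
  fixes \<phi> :: "'a \<times> 'a \<Rightarrow> real"
  assumes "B \<in> lmeasurable" "B \<subseteq> {0..}" "continuous_on UNIV \<phi>"
  shows "integrable (lebesgue_on B) (\<lambda>t. \<phi> (\<gamma> t, velocity t))"
proof -
  interpret finite_measure "lebesgue_on B"
    using assms(1) by (rule finite_measure_lebesgue_on)
  obtain K where K: "compact K" "\<And>t. 0 \<le> t \<Longrightarrow> (\<gamma> t, velocity t) \<in> K"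
    using bounded_phase_curve by blast
  have "bounded (\<phi> ` K)"
    using K(1) assms(3) by (intro compact_imp_bounded compact_continuous_image) (auto intro: continuous_on_subset)
  then obtain M where M: "\<And>z. z \<in> K \<Longrightarrow> norm (\<phi> z) \<le> M"
    unfolding bounded_iff by blast
  show ?thesis
  proof (rule integrable_const_bound)
    show "AE t in lebesgue_on B. norm (\<phi> (\<gamma> t, velocity t)) \<le> M"
      using assms(2) K(2) M by (intro AE_I2) (auto simp: space_restrict_space subset_iff)
    show "(\<lambda>t. \<phi> (\<gamma> t, velocity t)) \<in> borel_measurable (lebesgue_on B)"
      using assms by (intro measurable_compose[OF measurable_phase_curve] borel_measurable_continuous_onI) (auto dest: fmeasurableD)
  qed
qed

text \<open>Times up to \<open>T\<close> contribute at most \<open>T\<close> because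
  \<open>\<phi>\<close> is at most 1, later times at most \<open>a / 2\<close> per unit of length.
  Once \<open>|B n| > 2 * T / a\<close>, the sum is below \<open>a * |B n|\<close>.\<close>

lemma averages_vanish:
  fixes \<phi> :: "'a \<times> 'a \<Rightarrow> real"
  assumes B: "\<And>n. B n \<in> lmeasurable" "\<And>n. B n \<subseteq> {0..}"
    and growth: "filterlim (\<lambda>n. measure lebesgue (B n)) at_top F"
    and \<phi>: "continuous_on UNIV \<phi>" "\<And>z. 0 \<le> \<phi> z" "\<And>z. \<phi> z \<le> 1"
    and small: "\<And>\<delta>. 0 < \<delta> \<Longrightarrow> \<exists>T\<ge>0. \<forall>t\<ge>T. \<phi> (\<gamma> t, velocity t) \<le> \<delta>"
  shows "((\<lambda>n. (LINT t|lebesgue_on (B n). \<phi> (\<gamma> t, velocity t)) / measure lebesgue (B n)) \<longlongrightarrow> 0) F"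
proof (rule order_tendstoI)
  fix a :: real assume "a < 0"
  have "0 \<le> (LINT t|lebesgue_on (B n). \<phi> (\<gamma> t, velocity t)) / measure lebesgue (B n)" for n
    by (intro divide_nonneg_nonneg integral_nonneg) (auto simp: \<phi>)
  then show "\<forall>\<^sub>F n in F. a < (LINT t|lebesgue_on (B n). \<phi> (\<gamma> t, velocity t)) / measure lebesgue (B n)"
    using \<open>a < 0\<close> by (intro always_eventually) (meson less_le_trans)
next
  fix a :: real assume "0 < a"
  then obtain T where T: "0 \<le> T" "\<And>t. T \<le> t \<Longrightarrow> \<phi> (\<gamma> t, velocity t) \<le> a / 2"
    using small[of "a / 2"] by auto
  have le: "(LINT t|lebesgue_on (B n). \<phi> (\<gamma> t, velocity t)) \<le> a / 2 * measure lebesgue (B n) + T" for n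
  proof -
    interpret finite_measure "lebesgue_on (B n)"
      using B(1) by (rule finite_measure_lebesgue_on)
    have B': "B n \<in> sets lebesgue"
      using B(1) by (rule fmeasurableD)
    have BT: "B n \<inter> {0..T} \<in> sets (lebesgue_on (B n))"
      using B' by (auto simp: sets_restrict_space)
    have "(LINT t|lebesgue_on (B n). \<phi> (\<gamma> t, velocity t)) \<le>
      (LINT t|lebesgue_on (B n). a / 2 + indicator (B n \<inter> {0..T}) t)"
    proof (rule integral_mono)
      show "integrable (lebesgue_on (B n)) (\<lambda>t. \<phi> (\<gamma> t, velocity t))"
        using B \<phi>(1) by (intro integrable_phase_curve) auto
      show "integrable (lebesgue_on (B n)) (\<lambda>t. a / 2 + indicator (B n \<inter> {0..T}) t :: real)"
        using BT by (intro Bochner_Integration.integrable_add integrable_const) (simp add: emeasure_finite less_top[symmetric])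
      fix t assume t: "t \<in> space (lebesgue_on (B n))"
      then have "t \<in> B n" "0 \<le> t"
        using B(2) by (auto simp: space_restrict_space)
      then show "\<phi> (\<gamma> t, velocity t) \<le> a / 2 + indicator (B n \<inter> {0..T}) t"
        using T(2)[of t] \<phi>(3)[of "(\<gamma> t, velocity t)"] \<open>0 < a\<close> by (cases "t \<le> T") auto
    qed
    also have "\<dots> = a / 2 * measure lebesgue (B n) + measure lebesgue (B n \<inter> {0..T})"
    proof -
      have "measure (lebesgue_on (B n)) (space (lebesgue_on (B n))) = measure lebesgue (B n)"
        "measure (lebesgue_on (B n)) (B n \<inter> {0..T}) = measure lebesgue (B n \<inter> {0..T})"
        "B n \<inter> {0..T} \<inter> B n = B n \<inter> {0..T}"
        using B' by (auto simp: measure_restrict_space space_restrict_space)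
      then show ?thesis
        using BT by (subst Bochner_Integration.integral_add) (simp_all add: emeasure_finite less_top[symmetric] Int_absorb1 sets.sets_into_space)
    qed
    also have "measure lebesgue (B n \<inter> {0..T}) \<le> measure lebesgue {0..T}"
      using B' by (intro measure_mono_fmeasurable) auto
    finally show ?thesis
      using T(1) by simp
  qed
  have "\<forall>\<^sub>F n in F. 2 * T / a < measure lebesgue (B n) \<and> 0 < measure lebesgue (B n)"
    using growth by (intro eventually_conj) (simp_all add: filterlim_at_top_dense)
  then show "\<forall>\<^sub>F n in F. (LINT t|lebesgue_on (B n). \<phi> (\<gamma> t, velocity t)) / measure lebesgue (B n) < a"
  proof eventually_elim
    case (elim n)
    then have "T < a / 2 * measure lebesgue (B n)"
      using \<open>0 < a\<close> by (simp add: field_simps)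
    then have "(LINT t|lebesgue_on (B n). \<phi> (\<gamma> t, velocity t)) < a * measure lebesgue (B n)"
      using le[of n] by linarith
    then show ?case
      using elim by (simp add: divide_less_eq)
  qed
qed

text \<open>By the chain rule the integrand is the derivative of \<open>g\<close> along
  \<open>\<gamma>\<close> off the nodes, so the integral is a difference of two values of
  \<open>g\<close>, however long \<open>J\<close> is.\<close>

lemma integral_gradient_interval:
  assumes g: "\<And>x. GDERIV g x :> Dg x" "continuous_on UNIV Dg"
    and A: "\<And>t. 0 \<le> t \<Longrightarrow> \<bar>g (\<gamma> t)\<bar> \<le> A"
    and J: "is_interval J" "bounded J" "J \<subseteq> {0..}"
  shows "\<bar>LINT t|lebesgue_on J. Dg (\<gamma> t) \<bullet> velocity t\<bar> \<le> 2 * A"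
proof (cases "J = {}")
  case True
  then show ?thesis
    using A[of 0] by (simp add: integral_restrict_space)
next
  case False
  define a b where "a = Inf J" and "b = Sup J"
  have bdd: "bdd_below J" "bdd_above J"
    using J(2) by (auto simp: bounded_imp_bdd_below bounded_imp_bdd_above)
  have "a \<le> b"
    unfolding a_def b_def using bdd False by (metis cInf_le_cSup)
  have "0 \<le> a"
    unfolding a_def using False J(3) by (intro cInf_greatest) auto
  have sub: "J \<subseteq> {a..b}"
    unfolding a_def b_def using bdd by (auto intro: cInf_lower cSup_upper)
  have "{a<..<b} \<subseteq> J"
  proof
    fix t assume "t \<in> {a<..<b}"
    then obtain y z where "y \<in> J" "z \<in> J" "y < t" "t < z"
      unfolding a_def b_def using bdd False by (auto simp: cInf_less_iff less_cSup_iff)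
    then show "t \<in> J"
      using J(1) unfolding is_interval_1 by (meson less_imp_le)
  qed
  \<comment> \<open>\<open>J\<close> may lack its endpoints; it differs from the closed interval by
    at most two points, hence the integrals agree.\<close>
  then have diff: "{a..b} - J \<subseteq> {a, b}"
    by force
  \<comment> \<open>Only finitely many nodes precede \<open>b\<close>, and this version of the
    fundamental theorem admits finitely many exceptional points.\<close>
  obtain N where N: "\<And>n. n \<ge> N \<Longrightarrow> b < node n"
    using filterlim_node unfolding filterlim_at_top_dense eventually_sequentially by blast
  have "{a<..<b} \<inter> range node \<subseteq> node ` {..<N}"
  proof safe
    fix n assume n: "node n \<in> {a<..<b}"
    then have "n < N"
      using N[of n] by force
    then show "node n \<in> node ` {..<N}"
      by blast
  qed
  then have fin: "finite ({a<..<b} \<inter> range node)"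
    by (rule finite_subset) simp
  have contg: "continuous_on UNIV g"
    using g(1) by (meson continuous_at_imp_continuous_on gderiv_def has_derivative_continuous)
  have "((\<lambda>t. Dg (\<gamma> t) \<bullet> velocity t) has_integral (g (\<gamma> b) - g (\<gamma> a))) {a..b}"
  proof (rule fundamental_theorem_of_calculus_interior_strong[OF fin \<open>a \<le> b\<close>])
    fix t assume t: "t \<in> {a<..<b} - {a<..<b} \<inter> range node"
    have "(\<gamma> has_derivative (\<lambda>s. s *\<^sub>R velocity t)) (at t)"
      using \<gamma>_has_velocity[of t] t \<open>0 \<le> a\<close> by (auto simp: has_vector_derivative_def)
    then have "((\<lambda>t. g (\<gamma> t)) has_derivative (\<lambda>s. (s *\<^sub>R velocity t) \<bullet> Dg (\<gamma> t))) (at t)"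
      using g(1)[of "\<gamma> t"] unfolding gderiv_def by (rule has_derivative_compose)
    then show "((\<lambda>t. g (\<gamma> t)) has_vector_derivative Dg (\<gamma> t) \<bullet> velocity t) (at t)"
      by (simp add: has_vector_derivative_def inner_commute)
  next
    have "continuous_on {a..b} \<gamma>"
      using continuous_\<gamma> by (rule continuous_on_subset) (use \<open>0 \<le> a\<close> in auto)
    then show "continuous_on {a..b} (\<lambda>t. g (\<gamma> t))"
      by (rule continuous_on_compose2[OF contg]) auto
  qed
  moreover have "negligible {t \<in> J - {a..b}. P t}" "negligible {t \<in> {a..b} - J. P t}" for P
    by (rule negligible_subset[of "{a, b}"]; use sub diff in auto)+
  ultimately have "((\<lambda>t. Dg (\<gamma> t) \<bullet> velocity t) has_integral (g (\<gamma> b) - g (\<gamma> a))) J"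
    by (subst has_integral_spike_set_eq[where T = "{a..b}"])
  moreover have J': "J \<in> lmeasurable"
    using J by (intro measurable_convex) (auto simp: is_interval_convex)
  have "integrable (lebesgue_on J) (\<lambda>t. Dg (\<gamma> t) \<bullet> velocity t)"
    using integrable_phase_curve[OF J' J(3) continuous_on_gradient_pairing[OF g(2)]] by simp
  then have "(LINT t|lebesgue_on J. Dg (\<gamma> t) \<bullet> velocity t) = integral J (\<lambda>t. Dg (\<gamma> t) \<bullet> velocity t)"
    using J' by (intro lebesgue_integral_eq_integral) auto
  ultimately have "(LINT t|lebesgue_on J. Dg (\<gamma> t) \<bullet> velocity t) = g (\<gamma> b) - g (\<gamma> a)"
    by (simp add: integral_unique)
  then show ?thesis
    using A[of a] A[of b] \<open>0 \<le> a\<close> \<open>a \<le> b\<close> by simp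
qed

end

section \<open>The limit measure\<close>

locale subgradient_limit = subgradient_curve +
  fixes I :: "nat \<Rightarrow> real set" and k :: "nat \<Rightarrow> nat" and \<mu> :: "('a \<times> 'a) measure"
  assumes intervals: "\<And>i. i \<ge> 1 \<Longrightarrow> is_interval (I i) \<and> bounded (I i) \<and> I i \<subseteq> {0..}"
    and disjoint: "disjoint_family_on I {1..}"
    and lengths: "filterlim (\<lambda>i. measure lebesgue (I i)) at_top sequentially"
    and k: "filterlim k at_top sequentially"
    and sets_\<mu>: "sets \<mu> = sets borel"
    and limit: "weak_star_limit (\<lambda>i. curve_measure \<gamma> (\<Union>j\<in>{1..k i}. I j)) \<mu>"
begin

definition G :: "nat \<Rightarrow> real set" where "G i = (\<Union>j\<in>{1..k i}. I j)"

lemma interval_lmeasurable: "i \<ge> 1 \<Longrightarrow> I i \<in> lmeasurable"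
  using intervals by (intro measurable_convex) (auto simp: is_interval_convex)

lemma G_lmeasurable: "G i \<in> lmeasurable"
  unfolding G_def by (intro fmeasurable.finite_UN) (auto simp: interval_lmeasurable)

lemma G_nonneg: "G i \<subseteq> {0..}"
  using intervals by (fastforce simp: G_def)

lemma measure_G: "measure lebesgue (G i) = (\<Sum>j=1..k i. measure lebesgue (I j))"
  unfolding G_def
proof (rule measure_finite_Union)
  show "disjoint_family_on I {1..k i}"
    using disjoint by (auto simp: disjoint_family_on_def)
  show "emeasure lebesgue (I j) \<noteq> \<infinity>" if "j \<in> {1..k i}" for j
    using interval_lmeasurable[of j] that by (auto simp: fmeasurable_def)
qed (use interval_lmeasurable in \<open>auto dest: fmeasurableD\<close>)

lemma measure_G_superlinear:
  assumes "0 \<le> c"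
  shows "\<forall>\<^sub>F i in sequentially. c * real (k i) \<le> measure lebesgue (G i)"
  unfolding measure_G using assms by (intro partial_sums_superlinear[OF _ lengths k]) auto

lemma filterlim_measure_G: "filterlim (\<lambda>i. measure lebesgue (G i)) at_top sequentially"
  by (rule filterlim_at_top_mono[OF filterlim_compose[OF filterlim_real_sequentially k]])
     (use measure_G_superlinear[of 1] in simp)

lemma measure_G_pos: "\<forall>\<^sub>F i in sequentially. 0 < measure lebesgue (G i)"
  using filterlim_measure_G by (simp add: filterlim_at_top_dense)

lemma G_emeasure:
  assumes "0 < measure lebesgue (G i)"
  shows "emeasure lebesgue (G i) \<noteq> 0" "emeasure lebesgue (G i) \<noteq> \<infinity>"
  using assms G_lmeasurable[of i] by (auto simp: measure_def fmeasurable_def)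

text \<open>Turns the weak limit into a statement about time averages. The equality is only
  eventual, since \<open>G i\<close> may be null for small \<open>i\<close>.\<close>

lemma averages_tendsto:
  fixes \<phi> :: "'a \<times> 'a \<Rightarrow> real"
  assumes "continuous_on UNIV \<phi>"
  shows "(\<lambda>i. (LINT t|lebesgue_on (G i). \<phi> (\<gamma> t, velocity t)) / measure lebesgue (G i)) \<longlonglongrightarrow> (LINT z|\<mu>. \<phi> z)"
proof (rule Lim_transform_eventually)
  show "(\<lambda>i. LINT z|curve_measure \<gamma> (G i). \<phi> z) \<longlonglongrightarrow> (LINT z|\<mu>. \<phi> z)"
    using limit assms unfolding weak_star_limit_def G_def by blast
  show "\<forall>\<^sub>F i in sequentially. (LINT z|curve_measure \<gamma> (G i). \<phi> z) =
      (LINT t|lebesgue_on (G i). \<phi> (\<gamma> t, velocity t)) / measure lebesgue (G i)"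
    using measure_G_pos
    by eventually_elim (use assms G_emeasure G_nonneg fmeasurableD[OF G_lmeasurable] in
      \<open>auto intro!: integral_curve_measure borel_measurable_continuous_onI\<close>)
qed

lemma prob_space_\<mu>: "prob_space \<mu>"
proof -
  have "(\<lambda>i. (LINT t|lebesgue_on (G i). 1) / measure lebesgue (G i)) \<longlonglongrightarrow> (LINT z|\<mu>. 1)"
    by (rule averages_tendsto) simp
  moreover have "\<forall>\<^sub>F i in sequentially. (LINT t|lebesgue_on (G i). 1) / measure lebesgue (G i) = 1"
    using measure_G_pos
    by eventually_elim (use fmeasurableD[OF G_lmeasurable] in \<open>simp add: measure_restrict_space space_restrict_space\<close>)
  then have "(\<lambda>i. (LINT t|lebesgue_on (G i). 1) / measure lebesgue (G i)) \<longlonglongrightarrow> 1"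
    by (rule tendsto_eventually)
  ultimately have "measure \<mu> (space \<mu>) = 1"
    using LIMSEQ_unique by fastforce
  \<comment> \<open>\<open>measure\<close> is 0 on a set of infinite mass, so the value 1, obtained
    by testing with a constant function, rules that out.\<close>
  moreover from this have "emeasure \<mu> (space \<mu>) \<noteq> \<infinity>"
    by (auto simp: measure_def)
  ultimately show ?thesis
    by (intro prob_spaceI) (simp add: emeasure_eq_ennreal_measure)
qed

sublocale \<mu>: prob_space \<mu>
  by (rule prob_space_\<mu>)

text \<open>The limit of the averages is the integral of a nonnegative function that vanishes
  exactly on \<open>S\<close>. Nonemptiness matters because \<open>infdist\<close> to the empty set
  is 0 everywhere.\<close>

lemma AE_mem_if_averages_vanish:
  assumes "closed S" "S \<noteq> {}"
    and "(\<lambda>i. (LINT t|lebesgue_on (G i). min 1 (infdist (\<gamma> t, velocity t) S)) / measure lebesgue (G i)) \<longlonglongrightarrow> 0"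
  shows "AE z in \<mu>. z \<in> S"
proof -
  have cont: "continuous_on UNIV (\<lambda>z. min 1 (infdist z S))"
    by (intro continuous_intros)
  then have meas: "(\<lambda>z. min 1 (infdist z S)) \<in> borel_measurable \<mu>"
    using borel_measurable_continuous_onI sets_\<mu> measurable_cong_sets by blast
  have "integrable \<mu> (\<lambda>z. min 1 (infdist z S))"
    by (rule \<mu>.integrable_const_bound[of _ 1]) (use meas in \<open>auto simp: infdist_nonneg\<close>)
  moreover have "(LINT z|\<mu>. min 1 (infdist z S)) = 0"
    using LIMSEQ_unique[OF averages_tendsto[OF cont] assms(3)] .
  ultimately have "AE z in \<mu>. min 1 (infdist z S) = 0"
    by (subst (asm) integral_nonneg_eq_0_iff_AE) (auto simp: infdist_nonneg)
  then show ?thesis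
    by eventually_elim (use assms in \<open>auto simp: in_closed_iff_infdist_zero min_def split: if_splits\<close>)
qed

lemma compact_carrier: "\<exists>K. compact K \<and> (AE z in \<mu>. z \<in> K)"
proof -
  obtain K where K: "compact K" "\<And>t. 0 \<le> t \<Longrightarrow> (\<gamma> t, velocity t) \<in> K"
    using bounded_phase_curve by blast
  have "(LINT t|lebesgue_on (G i). min 1 (infdist (\<gamma> t, velocity t) K)) = 0" for i
    using G_nonneg[of i] K(2) by (intro integral_eq_zero_AE AE_I2) (auto simp: space_restrict_space subset_iff)
  moreover have "K \<noteq> {}"
    using K(2)[of 0] by auto
  ultimately show ?thesis
    using K(1) by (intro exI[of _ K]) (auto intro!: AE_mem_if_averages_vanish compact_imp_closed)
qed

lemma AE_neg_clarke_graph: "AE z in \<mu>. z \<in> {(x, v). - v \<in> clarke_subdiff f x}"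
proof (rule AE_mem_if_averages_vanish)
  let ?C = "{(x, v). - v \<in> clarke_subdiff f x}"
  show "closed ?C"
    using lip by (rule closed_neg_clarke_graph)
  show "?C \<noteq> {}"
  proof -
    have "(x 0, - v 0) \<in> ?C"
      using v_mem[of 0] by simp
    then show ?thesis
      by blast
  qed
  show "(\<lambda>i. (LINT t|lebesgue_on (G i). min 1 (infdist (\<gamma> t, velocity t) ?C)) / measure lebesgue (G i)) \<longlonglongrightarrow> 0"
  proof (rule averages_vanish[OF G_lmeasurable G_nonneg filterlim_measure_G])
    show "\<exists>T\<ge>0. \<forall>t\<ge>T. min 1 (infdist (\<gamma> t, velocity t) ?C) \<le> \<delta>" if "0 < \<delta>" for \<delta>
      using infdist_phase_curve_neg_clarke_graph[OF that] by (auto intro: min.coboundedI2)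
  qed (auto intro!: continuous_intros simp: infdist_nonneg)
qed

lemma integral_gradient_eq_0:
  assumes g: "\<And>x. GDERIV g x :> Dg x" "continuous_on UNIV Dg"
  shows "(LINT (x, v)|\<mu>. Dg x \<bullet> v) = 0"
proof -
  let ?h = "\<lambda>t. Dg (\<gamma> t) \<bullet> velocity t"
  note cont = continuous_on_gradient_pairing[OF g(2)]
  obtain K where K: "compact K" "\<And>t. 0 \<le> t \<Longrightarrow> (\<gamma> t, velocity t) \<in> K"
    using bounded_phase_curve by blast
  have contg: "continuous_on UNIV g"
    using g(1) by (meson continuous_at_imp_continuous_on gderiv_def has_derivative_continuous)
  have "compact ((\<lambda>z. g (fst z)) ` K)"
    by (intro compact_continuous_image K continuous_on_compose2[OF contg] continuous_on_fst continuous_on_id) auto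
  then obtain A where A: "\<forall>z\<in>K. \<bar>g (fst z)\<bar> \<le> A"
    by (auto dest!: compact_imp_bounded simp: bounded_iff)
  have A': "\<bar>g (\<gamma> t)\<bar> \<le> A" if "0 \<le> t" for t
    using bspec[OF A K(2)[OF that]] by simp
  have "0 \<le> A"
    using A'[of 0] by linarith
  have bound: "\<bar>LINT t|lebesgue_on (G i). ?h t\<bar> \<le> 2 * A * real (k i)" for i
  proof -
    have int: "set_integrable lebesgue (I j) ?h" if "j \<in> {1..k i}" for j
      using integrable_phase_curve[OF interval_lmeasurable _ cont, of j] intervals[of j] that
        fmeasurableD[OF interval_lmeasurable, of j]
      by (simp add: set_integrable_def integrable_restrict_space)
    have "(LINT t|lebesgue_on (G i). ?h t) = (LINT t:G i|lebesgue. ?h t)"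
      using fmeasurableD[OF G_lmeasurable] by (simp add: integral_restrict_space set_lebesgue_integral_def)
    also have "\<dots> = (\<Sum>j=1..k i. LINT t:I j|lebesgue. ?h t)"
      unfolding G_def using disjoint int fmeasurableD[OF interval_lmeasurable]
      by (intro set_integral_finite_Union) (auto simp: disjoint_family_on_def)
    also have "\<dots> = (\<Sum>j=1..k i. LINT t|lebesgue_on (I j). ?h t)"
      using fmeasurableD[OF interval_lmeasurable]
      by (intro sum.cong refl) (simp add: integral_restrict_space set_lebesgue_integral_def)
    also have "\<bar>\<dots>\<bar> \<le> (\<Sum>j=1..k i. 2 * A)"
      using intervals by (intro sum_abs[THEN order.trans] sum_mono integral_gradient_interval[OF g A']) auto
    finally show ?thesis
      by (simp add: mult.commute)
  qed
  have "(\<lambda>i. (LINT t|lebesgue_on (G i). ?h t) / measure lebesgue (G i)) \<longlonglongrightarrow> 0"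
  proof (rule tendstoI)
    fix e :: real assume "0 < e"
    have "\<forall>\<^sub>F i in sequentially. 1 \<le> k i"
      using k by (simp add: filterlim_at_top)
    \<comment> \<open>The bound is \<open>2 * A * real (k i)\<close>; the extra 1 makes the final
      estimate strict, as \<open>1 \<le> k i\<close>.\<close>
    moreover have "\<forall>\<^sub>F i in sequentially. (2 * A + 1) / e * real (k i) \<le> measure lebesgue (G i)"
      using \<open>0 \<le> A\<close> \<open>0 < e\<close> by (intro measure_G_superlinear) simp
    ultimately show "\<forall>\<^sub>F i in sequentially. dist ((LINT t|lebesgue_on (G i). ?h t) / measure lebesgue (G i)) 0 < e"
      using measure_G_pos
    proof eventually_elim
      case (elim i)
      have "\<bar>LINT t|lebesgue_on (G i). ?h t\<bar> < (2 * A + 1) * real (k i)"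
        using bound[of i] elim(1) by (simp add: algebra_simps)
      also have "\<dots> \<le> e * measure lebesgue (G i)"
        using elim(2) \<open>0 < e\<close> by (simp add: field_simps)
      finally show ?case
        using elim(3) by (simp add: abs_divide divide_less_eq)
    qed
  qed
  with averages_tendsto[OF cont] have "(LINT z|\<mu>. Dg (fst z) \<bullet> snd z) = 0"
    using LIMSEQ_unique by fastforce
  then show ?thesis
    by (simp add: case_prod_unfold)
qed

lemma closed_measure_\<mu>: "closed_measure \<mu>"
  unfolding closed_measure_def
proof (intro conjI allI impI)
  show "emeasure \<mu> K < \<infinity>" for K
    by (simp add: less_top[symmetric])
  obtain K where K: "compact K" "AE z in \<mu>. z \<in> K"
    using compact_carrier by blast
  \<comment> \<open>Written as the complement of all null open sets, the support is visibly closed;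
    it lies in \<open>K\<close> because the open complement of \<open>K\<close> is null.\<close>
  have "measure_support \<mu> = - \<Union> {V. open V \<and> emeasure \<mu> V = 0}"
    by (auto simp: measure_support_def zero_less_iff_neq_zero)
  moreover have "open (\<Union> {V. open V \<and> emeasure \<mu> V = 0})"
    by blast
  ultimately have "closed (measure_support \<mu>)"
    by (simp only: closed_Compl)
  moreover have "measure_support \<mu> \<subseteq> K"
  proof -
    have "emeasure \<mu> (- K) = 0"
      using K sets_\<mu> by (subst AE_iff_measurable[symmetric, where P = "\<lambda>z. z \<in> K"])
        (auto simp: compact_imp_closed borel_closed sets_eq_imp_space_eq[OF sets_\<mu>])
    moreover have "open (- K)"
      using K(1) by (simp add: compact_imp_closed open_Compl)
    ultimately show ?thesis
      by (auto simp: measure_support_def)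
  qed
  ultimately show "compact (measure_support \<mu>)"
    using K(1) by (metis closed_Int_compact inf.absorb1)
  fix g :: "'a \<Rightarrow> real" and Dg
  assume "smooth_fun g \<and> (\<forall>x. GDERIV g x :> Dg x)"
  then show "(LINT (x, v)|\<mu>. Dg x \<bullet> v) = 0"
    using integral_gradient_eq_0 smooth_fun_continuous_gradient by blast
qed (rule sets_\<mu>)

end

section \<open>Stationary measures on curves\<close>

lemma has_vector_derivative_iff_difference_quotient:
  "(\<beta> has_vector_derivative D) (at t) \<longleftrightarrow> ((\<lambda>h. (\<beta> (t + h) - \<beta> t) /\<^sub>R h) \<longlongrightarrow> D) (at 0)"
proof -
  have eq: "norm (\<beta> (t + h) - \<beta> t - h *\<^sub>R D) / norm h = norm ((\<beta> (t + h) - \<beta> t) /\<^sub>R h - D)" if "h \<noteq> 0" for h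
  proof -
    have "(\<beta> (t + h) - \<beta> t) /\<^sub>R h - D = (\<beta> (t + h) - \<beta> t - h *\<^sub>R D) /\<^sub>R h"
      using that by (simp add: scaleR_diff_right)
    then show ?thesis
      by (simp add: divide_inverse mult.commute)
  qed
  have "(\<beta> has_vector_derivative D) (at t) \<longleftrightarrow> ((\<lambda>h. norm (\<beta> (t + h) - \<beta> t - h *\<^sub>R D) / norm h) \<longlongrightarrow> 0) (at 0)"
    unfolding has_vector_derivative_def has_derivative_at by (simp add: bounded_linear_scaleR_left)
  also have "\<dots> \<longleftrightarrow> ((\<lambda>h. norm ((\<beta> (t + h) - \<beta> t) /\<^sub>R h - D)) \<longlongrightarrow> 0) (at 0)"
    by (rule tendsto_cong) (use eq in \<open>auto simp: eventually_at_filter\<close>)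
  also have "\<dots> \<longleftrightarrow> ((\<lambda>h. (\<beta> (t + h) - \<beta> t) /\<^sub>R h) \<longlongrightarrow> D) (at 0)"
    using Lim_null[of "\<lambda>h. (\<beta> (t + h) - \<beta> t) /\<^sub>R h" D "at 0"] by (simp add: tendsto_norm_zero_iff)
  finally show ?thesis .
qed

section \<open>Differentiability of curves through countably many increments\<close>

definition difference_quotient :: "(real \<Rightarrow>\<^sub>C 'a::euclidean_space) \<Rightarrow> real \<Rightarrow> real \<Rightarrow> 'a" where
  "difference_quotient \<beta> t h = (apply_bcontfun \<beta> (t + h) - apply_bcontfun \<beta> t) /\<^sub>R h"

definition sequential_derivative :: "(real \<Rightarrow>\<^sub>C 'a::euclidean_space) \<Rightarrow> real \<Rightarrow> 'a" where
  "sequential_derivative \<beta> t = lim (\<lambda>n. difference_quotient \<beta> t (inverse (real (Suc n))))"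

text \<open>All quantifiers range over countable sets, so measurability follows from that of single
  difference quotients. The candidate derivative is fixed in advance, which avoids an uncountable
  existential quantifier.\<close>

definition rationally_differentiable :: "(real \<Rightarrow>\<^sub>C 'a::euclidean_space) \<Rightarrow> real \<Rightarrow> bool" where
  "rationally_differentiable \<beta> t \<longleftrightarrow> (\<forall>n::nat. \<exists>m::nat. \<forall>h::rat. h \<noteq> 0 \<longrightarrow>
     \<bar>real_of_rat h\<bar> < inverse (real (Suc m)) \<longrightarrow>
     dist (difference_quotient \<beta> t (real_of_rat h)) (sequential_derivative \<beta> t) \<le> inverse (real (Suc n)))"

lemma sequential_derivative_eq:
  assumes "(apply_bcontfun \<beta> has_vector_derivative D) (at t)"
  shows "sequential_derivative \<beta> t = D"
proof -
  have "(\<lambda>n. difference_quotient \<beta> t (inverse (real (Suc n)))) \<longlonglongrightarrow> D"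
    unfolding difference_quotient_def
    by (rule filterlim_compose[OF assms[unfolded has_vector_derivative_iff_difference_quotient]])
       (use LIMSEQ_inverse_real_of_nat in \<open>auto simp: filterlim_at\<close>)
  then show ?thesis
    unfolding sequential_derivative_def by (rule limI)
qed

lemma rationally_differentiable_iff:
  "rationally_differentiable \<beta> t \<longleftrightarrow> (apply_bcontfun \<beta> has_vector_derivative sequential_derivative \<beta> t) (at t)"
  (is "_ \<longleftrightarrow> (_ has_vector_derivative ?D) _")
proof
  assume "(apply_bcontfun \<beta> has_vector_derivative ?D) (at t)"
  then have lim: "(difference_quotient \<beta> t \<longlongrightarrow> ?D) (at 0)"
    by (simp add: has_vector_derivative_iff_difference_quotient difference_quotient_def[abs_def])
  show "rationally_differentiable \<beta> t"
    unfolding rationally_differentiable_def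
  proof
    fix n :: nat
    have "\<forall>\<^sub>F h in at 0. dist (difference_quotient \<beta> t h) ?D < inverse (real (Suc n))"
      using lim by (rule tendstoD) simp
    then obtain d where d: "d > 0" "\<And>h. h \<noteq> 0 \<Longrightarrow> \<bar>h\<bar> < d \<Longrightarrow> dist (difference_quotient \<beta> t h) ?D < inverse (real (Suc n))"
      unfolding eventually_at by (auto simp: dist_real_def)
    obtain m where "inverse (real (Suc m)) < d"
      using reals_Archimedean[OF d(1)] by blast
    then show "\<exists>m::nat. \<forall>h::rat. h \<noteq> 0 \<longrightarrow> \<bar>real_of_rat h\<bar> < inverse (real (Suc m)) \<longrightarrow>
      dist (difference_quotient \<beta> t (real_of_rat h)) ?D \<le> inverse (real (Suc n))"
      using d(2) by (intro exI[of _ m] allI impI less_imp_le) auto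
  qed
next
  assume rat: "rationally_differentiable \<beta> t"
  have "(difference_quotient \<beta> t \<longlongrightarrow> ?D) (at 0)"
  proof (rule tendstoI)
    fix e :: real assume "0 < e"
    then obtain n where n: "inverse (real (Suc n)) < e"
      using reals_Archimedean by blast
    obtain m where m: "\<And>h::rat. h \<noteq> 0 \<Longrightarrow> \<bar>real_of_rat h\<bar> < inverse (real (Suc m)) \<Longrightarrow>
       dist (difference_quotient \<beta> t (real_of_rat h)) ?D \<le> inverse (real (Suc n))"
      using rat unfolding rationally_differentiable_def by blast
    \<comment> \<open>For \<open>h \<noteq> 0\<close> the quotient is continuous in
      \<open>h\<close>, so a violation at a real increment persists at a nearby rational
      one.\<close>
    have "dist (difference_quotient \<beta> t h) ?D < e" if h: "h \<noteq> 0" "\<bar>h\<bar> < inverse (real (Suc m))" for h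
    proof (rule ccontr)
      assume "\<not> dist (difference_quotient \<beta> t h) ?D < e"
      then have gt: "inverse (real (Suc n)) < dist (difference_quotient \<beta> t h) ?D"
        using n by linarith
      have "isCont (apply_bcontfun \<beta>) (t + h)"
        using iffD1[OF continuous_on_eq_continuous_at[OF open_UNIV] continuous_on_apply_bcontfun[of UNIV \<beta>]]
        by simp
      then have "isCont (\<lambda>s. apply_bcontfun \<beta> (t + s)) h"
        by (rule isCont_o2[rotated]) (rule continuous_add[OF continuous_const continuous_ident])
      then have "((\<lambda>s. apply_bcontfun \<beta> (t + s)) \<longlongrightarrow> apply_bcontfun \<beta> (t + h)) (nhds h)"
        using tendsto_at_iff_tendsto_nhds[of "\<lambda>s. apply_bcontfun \<beta> (t + s)" h] by (simp add: isCont_def)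
      moreover have "((\<lambda>s. s) \<longlongrightarrow> h) (nhds h)"
        by (rule filterlim_ident)
      ultimately have "((\<lambda>s. dist (difference_quotient \<beta> t s) ?D) \<longlongrightarrow> dist (difference_quotient \<beta> t h) ?D) (nhds h)"
        unfolding difference_quotient_def using h(1)
        by (intro tendsto_dist tendsto_scaleR tendsto_inverse tendsto_diff tendsto_const)
      then have "\<forall>\<^sub>F s in nhds h. inverse (real (Suc n)) < dist (difference_quotient \<beta> t s) ?D"
        using gt by (rule order_tendstoD)
      moreover have "\<forall>\<^sub>F s in nhds h. s \<in> - {0} \<inter> ball 0 (inverse (real (Suc m)))"
        using h by (intro eventually_nhds_in_open open_Int) auto
      ultimately have "\<forall>\<^sub>F s in nhds h. inverse (real (Suc n)) < dist (difference_quotient \<beta> t s) ?D \<and>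
          s \<in> - {0} \<inter> ball 0 (inverse (real (Suc m)))"
        by eventually_elim auto
      then obtain d where d: "d > 0" "\<And>s. dist s h < d \<Longrightarrow> inverse (real (Suc n)) < dist (difference_quotient \<beta> t s) ?D \<and>
          s \<in> - {0} \<inter> ball 0 (inverse (real (Suc m)))"
        unfolding eventually_nhds_metric by blast
      obtain r where "h < real_of_rat r" "real_of_rat r < h + d"
        using of_rat_dense[of h "h + d"] d(1) by auto
      then have "inverse (real (Suc n)) < dist (difference_quotient \<beta> t (real_of_rat r)) ?D"
        "r \<noteq> 0" "\<bar>real_of_rat r\<bar> < inverse (real (Suc m))"
        using d(2)[of "real_of_rat r"] by (auto simp: dist_real_def)
      then show False
        using m[of r] by linarith
    qed
    then show "\<forall>\<^sub>F h in at 0. dist (difference_quotient \<beta> t h) ?D < e"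
      unfolding eventually_at by (intro exI[of _ "inverse (real (Suc m))"]) (auto simp: dist_real_def)
  qed
  then show "(apply_bcontfun \<beta> has_vector_derivative ?D) (at t)"
    by (simp add: has_vector_derivative_iff_difference_quotient difference_quotient_def[abs_def])
qed

lemma rationally_differentiable_iff_differentiable:
  "rationally_differentiable \<beta> t \<longleftrightarrow> apply_bcontfun \<beta> differentiable (at t)"
  using rationally_differentiable_iff sequential_derivative_eq vector_derivative_works
    differentiableI_vector by metis

lemma translate_simps:
  "difference_quotient (translate s \<beta>) t h = difference_quotient \<beta> (t + s) h"
  "sequential_derivative (translate s \<beta>) t = sequential_derivative \<beta> (t + s)"
  "rationally_differentiable (translate s \<beta>) t = rationally_differentiable \<beta> (t + s)"
proof -
  show *: "difference_quotient (translate s \<beta>) t h = difference_quotient \<beta> (t + s) h" for h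
    by (simp add: difference_quotient_def add.assoc add.commute[of s])
  show **: "sequential_derivative (translate s \<beta>) t = sequential_derivative \<beta> (t + s)"
    by (simp add: sequential_derivative_def *)
  show "rationally_differentiable (translate s \<beta>) t = rationally_differentiable \<beta> (t + s)"
    by (simp add: rationally_differentiable_def * **)
qed

locale stationary_curve_measure = prob_space \<nu>
  for \<nu> :: "(real \<Rightarrow>\<^sub>C 'a::euclidean_space) measure" and U :: "'a set" +
  assumes sets_\<nu>: "sets \<nu> = sets (restrict_space borel (Lip_curves U))"
    and stationary: "\<And>t. distr \<nu> \<nu> (translate t) = \<nu>"
begin

lemma space_\<nu>: "space \<nu> = Lip_curves U"
  using sets_eq_imp_space_eq[OF sets_\<nu>] by (simp add: space_restrict_space)

text \<open>Covers evaluation at a time and translation, which do not increase distances in the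
  supremum metric.\<close>

lemma measurable_if_nonexpansive:
  fixes F :: "(real \<Rightarrow>\<^sub>C 'a) \<Rightarrow> 'b::metric_space"
  assumes "\<And>\<beta> \<beta>'. dist (F \<beta>) (F \<beta>') \<le> dist \<beta> \<beta>'"
  shows "F \<in> borel_measurable \<nu>"
proof -
  have "1-lipschitz_on UNIV F"
    by (rule lipschitz_onI) (use assms in auto)
  then have "F \<in> borel_measurable borel"
    by (intro borel_measurable_continuous_onI lipschitz_on_continuous_on)
  then have "F \<in> borel_measurable (restrict_space borel (Lip_curves U))"
    by (rule measurable_restrict_space1)
  then show ?thesis
    using measurable_cong_sets[OF sets_\<nu> refl] by blast
qed

lemma measurable_eval: "(\<lambda>\<beta>. apply_bcontfun \<beta> t) \<in> borel_measurable \<nu>"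
  by (rule measurable_if_nonexpansive) (rule dist_bounded)

lemma measurable_translate: "translate t \<in> measurable \<nu> \<nu>"
proof -
  have "translate t \<in> borel_measurable \<nu>"
    by (rule measurable_if_nonexpansive) (auto intro!: dist_bound dist_bounded)
  moreover have "translate t \<beta> \<in> Lip_curves U" if \<beta>: "\<beta> \<in> Lip_curves U" for \<beta>
  proof -
    obtain L where "L-lipschitz_on UNIV (apply_bcontfun \<beta>)"
      using \<beta> by (auto simp: Lip_curves_def)
    then have "L-lipschitz_on UNIV (apply_bcontfun (translate t \<beta>))"
      by (auto simp: lipschitz_on_def dist_real_def algebra_simps dest!: bspec)
         (metis add_diff_cancel_right UNIV_I)
    then show ?thesis
      using \<beta> by (auto simp: Lip_curves_def)
  qed
  ultimately have "translate t \<in> measurable \<nu> (restrict_space borel (Lip_curves U))"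
    by (intro measurable_restrict_space2) (auto simp: space_\<nu>)
  then show ?thesis
    using measurable_cong_sets[OF refl sets_\<nu>] by blast
qed

lemma AE_translate:
  assumes "AE \<beta> in \<nu>. P \<beta>"
  shows "AE \<beta> in \<nu>. P (translate t \<beta>)"
  by (rule AE_distrD[OF measurable_translate]) (subst stationary, rule assms)

text \<open>The space of curves is not separable, so joint measurability of the evaluation is obtained
  from its continuity in time.\<close>

lemma measurable_eval_pair:
  "(\<lambda>z. apply_bcontfun (fst z) (snd z)) \<in> borel_measurable (\<nu> \<Otimes>\<^sub>M lborel)"
proof (rule borel_measurable_LIMSEQ_metric)
  \<comment> \<open>Time is rounded down to the grid of mesh \<open>1 / (n + 1)\<close>. Each
    approximation uses countably many evaluations, and continuity of the curve gives the
    limit.\<close>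
  let ?u = "\<lambda>n z. apply_bcontfun (fst z) (real_of_int \<lfloor>real (Suc n) * snd z\<rfloor> / real (Suc n))"
  show "?u n \<in> borel_measurable (\<nu> \<Otimes>\<^sub>M lborel)" for n
  proof (rule measurable_compose_countable[where f = "\<lambda>i z. apply_bcontfun (fst z) (real_of_int i / real (Suc n))"])
    show "(\<lambda>z. apply_bcontfun (fst z) (real_of_int i / real (Suc n))) \<in> borel_measurable (\<nu> \<Otimes>\<^sub>M lborel)" for i
      using measurable_compose[OF measurable_fst measurable_eval] .
    show "(\<lambda>z. \<lfloor>real (Suc n) * snd z\<rfloor>) \<in> (\<nu> \<Otimes>\<^sub>M lborel) \<rightarrow>\<^sub>M count_space UNIV"
      by measurable
  qed
  fix z :: "(real \<Rightarrow>\<^sub>C 'a) \<times> real"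
  have "(\<lambda>n. real_of_int \<lfloor>real (Suc n) * snd z\<rfloor> / real (Suc n) - snd z) \<longlonglongrightarrow> 0"
  proof (rule Lim_null_comparison[OF _ LIMSEQ_inverse_real_of_nat], intro always_eventually allI)
    fix n
    have "\<bar>real_of_int \<lfloor>real (Suc n) * snd z\<rfloor> - real (Suc n) * snd z\<bar> \<le> 1"
      by linarith
    moreover have "real_of_int \<lfloor>real (Suc n) * snd z\<rfloor> / real (Suc n) - snd z =
        (real_of_int \<lfloor>real (Suc n) * snd z\<rfloor> - real (Suc n) * snd z) / real (Suc n)"
      by (simp add: field_simps)
    ultimately show "norm (real_of_int \<lfloor>real (Suc n) * snd z\<rfloor> / real (Suc n) - snd z) \<le> inverse (real (Suc n))"
      by (simp add: abs_divide divide_right_mono inverse_eq_divide del: of_nat_Suc)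
  qed
  then have "(\<lambda>n. real_of_int \<lfloor>real (Suc n) * snd z\<rfloor> / real (Suc n)) \<longlonglongrightarrow> snd z"
    by (simp add: LIM_zero_iff)
  then show "(\<lambda>n. ?u n z) \<longlonglongrightarrow> apply_bcontfun (fst z) (snd z)"
    by (rule continuous_on_tendsto_compose[OF continuous_on_apply_bcontfun[of UNIV]]) auto
qed

lemma measurable_difference_quotient [measurable]:
  "(\<lambda>z. difference_quotient (fst z) (snd z) h) \<in> borel_measurable (\<nu> \<Otimes>\<^sub>M lborel)"
proof -
  have "(\<lambda>z. (fst z, snd z + h)) \<in> (\<nu> \<Otimes>\<^sub>M lborel) \<rightarrow>\<^sub>M (\<nu> \<Otimes>\<^sub>M lborel)"
    by measurable
  from measurable_compose[OF this measurable_eval_pair]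
  have "(\<lambda>z. apply_bcontfun (fst z) (snd z + h)) \<in> borel_measurable (\<nu> \<Otimes>\<^sub>M lborel)"
    by simp
  then show ?thesis
    unfolding difference_quotient_def using measurable_eval_pair by measurable
qed

lemma measurable_sequential_derivative [measurable]:
  "(\<lambda>z. sequential_derivative (fst z) (snd z)) \<in> borel_measurable (\<nu> \<Otimes>\<^sub>M lborel)"
  unfolding sequential_derivative_def by (rule borel_measurable_lim_metric) measurable

lemma measurable_rationally_differentiable [measurable]:
  "Measurable.pred (\<nu> \<Otimes>\<^sub>M lborel) (\<lambda>z. rationally_differentiable (fst z) (snd z))"
  unfolding rationally_differentiable_def by measurable

text \<open>At a point of nondifferentiability the derivative has a junk value, which does not depend on the curve.\<close>

lemma measurable_vector_derivative:
  "(\<lambda>\<beta>. vector_derivative (apply_bcontfun \<beta>) (at t)) \<in> borel_measurable \<nu>"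
proof -
  have eq: "vector_derivative (apply_bcontfun \<beta>) (at t) =
    (if rationally_differentiable \<beta> t then sequential_derivative \<beta> t else (SOME w. False))" for \<beta> :: "real \<Rightarrow>\<^sub>C 'a"
  proof (cases "rationally_differentiable \<beta> t")
    case True
    then show ?thesis
      by (simp add: rationally_differentiable_iff vector_derivative_at)
  next
    case False
    then have "\<not> (apply_bcontfun \<beta> has_vector_derivative w) (at t)" for w
      using differentiableI_vector rationally_differentiable_iff_differentiable by blast
    then show ?thesis
      using False by (simp add: vector_derivative_def)
  qed
  have pair: "(\<lambda>\<beta>. (\<beta>, t)) \<in> \<nu> \<rightarrow>\<^sub>M (\<nu> \<Otimes>\<^sub>M lborel)"
    by measurable
  show ?thesis
    unfolding eq
    using measurable_compose[OF pair measurable_rationally_differentiable]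
      measurable_compose[OF pair measurable_sequential_derivative]
    by (intro measurable_If) (auto simp: pred_def)
qed

interpretation lb: pair_sigma_finite \<nu> "lborel :: real measure"
  by unfold_locales

text \<open>By Fubini, almost every curve is differentiable at some fixed time, and by stationarity at
  every fixed time.\<close>

lemma AE_rationally_differentiable_0: "AE \<beta> in \<nu>. rationally_differentiable \<beta> 0"
proof -
  have "AE \<beta> in \<nu>. AE t in lborel. rationally_differentiable \<beta> t"
  proof (rule AE_I2)
    fix \<beta> assume "\<beta> \<in> space \<nu>"
    then obtain L where "L-lipschitz_on UNIV (apply_bcontfun \<beta>)"
      by (auto simp: space_\<nu> Lip_curves_def)
    then have "{t. \<not> apply_bcontfun \<beta> differentiable (at t)} \<in> null_sets lebesgue"
      using lipschitz_differentiable_ae negligible_iff_null_sets by blast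
    then have "AE t in lebesgue. rationally_differentiable \<beta> t"
      by (intro AE_I'[of "{t. \<not> apply_bcontfun \<beta> differentiable (at t)}"])
         (auto simp: rationally_differentiable_iff_differentiable)
    then show "AE t in lborel. rationally_differentiable \<beta> t"
      by (simp add: AE_completion_iff)
  qed
  then have AE: "AE t in lborel. AE \<beta> in \<nu>. rationally_differentiable \<beta> t"
    using lb.AE_commute[OF measurable_rationally_differentiable[unfolded pred_def]] by simp
  \<comment> \<open>Lebesgue measure is not zero, so a property of almost every time holds at some
    time.\<close>
  have "ae_filter (lborel :: real measure) \<noteq> bot"
    by (simp add: ae_filter_eq_bot_iff)
  from eventually_happens'[OF this AE] obtain t where "AE \<beta> in \<nu>. rationally_differentiable \<beta> t"
    by blast
  \<comment> \<open>The curve shifted by \<open>- t\<close> behaves at time \<open>t\<close> as the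
    original curve does at time 0.\<close>
  from AE_translate[OF this, of "- t"] show ?thesis
    by (simp add: translate_simps)
qed

theorem AE_curve_AE_time:
  assumes "C \<in> sets borel"
    and "AE \<beta> in \<nu>. (apply_bcontfun \<beta> 0, vector_derivative (apply_bcontfun \<beta>) (at 0)) \<in> C"
  shows "AE \<beta> in \<nu>. AE t in lebesgue. \<exists>w. (apply_bcontfun \<beta> has_vector_derivative w) (at t) \<and> (apply_bcontfun \<beta> t, w) \<in> C"
proof -
  \<comment> \<open>\<open>sequential_derivative\<close> replaces \<open>vector_derivative\<close>
    here because its joint measurability, required for exchanging the two almost-everywhere
    quantifiers, is available. Both agree where the curve is differentiable.\<close>
  define P where "P \<beta> t \<longleftrightarrow> rationally_differentiable \<beta> t \<and> (apply_bcontfun \<beta> t, sequential_derivative \<beta> t) \<in> C" for \<beta> t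
  have "AE \<beta> in \<nu>. P \<beta> 0"
    using AE_rationally_differentiable_0 assms(2)
    by eventually_elim (auto simp: P_def rationally_differentiable_iff dest: vector_derivative_at)
  then have "AE \<beta> in \<nu>. P \<beta> t" for t
    using AE_translate[of "\<lambda>\<beta>. P \<beta> 0" t] by (simp add: P_def translate_simps)
  then have "AE t in lborel. AE \<beta> in \<nu>. P \<beta> t"
    by simp
  moreover have "{z \<in> space (\<nu> \<Otimes>\<^sub>M lborel). P (fst z) (snd z)} \<in> sets (\<nu> \<Otimes>\<^sub>M lborel)"
  proof -
    have "(\<lambda>z. (apply_bcontfun (fst z) (snd z), sequential_derivative (fst z) (snd z))) \<in> borel_measurable (\<nu> \<Otimes>\<^sub>M lborel)"
      by (intro borel_measurable_Pair measurable_eval_pair measurable_sequential_derivative)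
    then have "Measurable.pred (\<nu> \<Otimes>\<^sub>M lborel) (\<lambda>z. (apply_bcontfun (fst z) (snd z), sequential_derivative (fst z) (snd z)) \<in> C)"
      using assms(1) by (rule pred_sets2[rotated])
    with measurable_rationally_differentiable show ?thesis
      unfolding P_def pred_def by (rule sets.sets_Collect_conj[rotated])
  qed
  ultimately have "AE \<beta> in \<nu>. AE t in lborel. P \<beta> t"
    by (subst lb.AE_commute)
  then show ?thesis
  proof eventually_elim
    case (elim \<beta>)
    then have "AE t in lebesgue. P \<beta> t"
      by (rule AE_completion)
    then show ?case
      by eventually_elim (auto simp: P_def rationally_differentiable_iff)
  qed
qed

end

section \<open>Curves in the support of the stationary measure\<close>

context subgradient_limit
begin

lemma AE_centroid_neg_clarke_graph:
  assumes \<kappa>: "disintegration \<mu> \<kappa>"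
  shows "AE y in distr \<mu> borel fst. (y, centroid \<kappa> y) \<in> {(x, v). - v \<in> clarke_subdiff f x}"
proof -
  let ?C = "{(x, v). - v \<in> clarke_subdiff f x}"
  obtain K where K: "compact K" "AE z in \<mu>. z \<in> K"
    using compact_carrier by blast
  obtain R where R: "\<And>z. z \<in> K \<Longrightarrow> norm z \<le> R"
    using compact_imp_bounded[OF K(1)] unfolding bounded_iff by blast
  \<comment> \<open>Intersecting with the compact carrier makes velocities bounded on almost every
    fibre, so the centroid is the integral of an integrable function.\<close>
  define A where "A = - (?C \<inter> K)"
  have open_A: "open A"
    unfolding A_def by (intro open_Compl closed_Int compact_imp_closed K(1) closed_neg_clarke_graph lip)
  then have A: "A \<in> sets borel"
    by (rule borel_open)
  have "AE z in \<mu>. z \<notin> A"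
    using AE_neg_clarke_graph K(2) by eventually_elim (simp add: A_def)
  then have "emeasure \<mu> A = 0"
    using A sets_\<mu> by (subst (asm) AE_iff_measurable[of A]) (auto simp: sets_eq_imp_space_eq[OF sets_\<mu>])
  \<comment> \<open>The disintegration turns the null set \<open>A\<close> into null slices over
    almost every base point.\<close>
  then have 0: "(\<integral>\<^sup>+y. emeasure (\<kappa> y) {v. (y, v) \<in> A} \<partial>distr \<mu> borel fst) = 0"
    using \<kappa> A unfolding disintegration_def by auto
  have \<kappa>_meas: "\<kappa> \<in> borel \<rightarrow>\<^sub>M prob_algebra borel"
    using \<kappa> by (simp add: disintegration_def)
  have "(\<lambda>y. emeasure (\<kappa> y) {v. (y, v) \<in> A}) \<in> borel_measurable borel"
  proof (rule emeasure_measurable_subprob_algebra2[OF _ measurable_prob_algebraD[OF \<kappa>_meas]])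
    have eq: "(SIGMA y:space borel. {v. (y, v) \<in> A}) = A"
      by auto
    show "(SIGMA y:space borel. {v. (y, v) \<in> A}) \<in> sets (borel \<Otimes>\<^sub>M borel)"
      unfolding eq borel_prod by (rule A)
  qed
  then have "AE y in distr \<mu> borel fst. emeasure (\<kappa> y) {v. (y, v) \<in> A} = 0"
    using 0 by (subst (asm) nn_integral_0_iff_AE) (auto cong: measurable_cong_sets)
  then show ?thesis
  proof eventually_elim
    case (elim y)
    have "\<kappa> y \<in> space (prob_algebra borel)"
      using measurable_space[OF \<kappa>_meas] by simp
    then have sets_\<kappa>: "sets (\<kappa> y) = sets borel" and "prob_space (\<kappa> y)"
      by (auto simp: space_prob_algebra)
    interpret \<kappa>: prob_space "\<kappa> y" by fact
    have "open (Pair y -` A)"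
      by (intro open_vimage[OF open_A] continuous_intros)
    then have "{v. (y, v) \<in> A} \<in> sets (\<kappa> y)"
      unfolding sets_\<kappa> vimage_def by (rule borel_open)
    with elim have "AE v in \<kappa> y. (y, v) \<notin> A"
      by (subst AE_iff_measurable[of "{v. (y, v) \<in> A}"]) (auto simp: sets_eq_imp_space_eq[OF sets_\<kappa>])
    then have AE: "AE v in \<kappa> y. - v \<in> clarke_subdiff f y \<and> norm v \<le> R"
    proof eventually_elim
      case (elim v)
      then have "(y, v) \<in> ?C" "(y, v) \<in> K"
        by (auto simp: A_def)
      then show ?case
        using R[of "(y, v)"] norm_snd_le[of v y] by auto
    qed
    have "(\<lambda>v. - v) \<in> borel_measurable (\<kappa> y)"
      by (simp cong: measurable_cong_sets add: sets_\<kappa>)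
    then have "integrable (\<kappa> y) (\<lambda>v. - v)"
      using AE by (intro \<kappa>.integrable_const_bound[of _ R]) auto
    then have "(LINT v|\<kappa> y. - v) \<in> clarke_subdiff f y"
      using AE by (intro \<kappa>.expectation_mem_closed_convex closed_clarke_subdiff convex_clarke_subdiff) auto
    then show ?case
      by (simp add: centroid_def)
  qed
qed

end

text \<open>The derivative is an explicit witness \<open>w\<close>, so that differentiability at
  almost every time is part of the claim and no arbitrary value of \<open>vector_derivative\<close>
  can satisfy it.\<close>

theorem corollary22:
  fixes f :: "'a::euclidean_space \<Rightarrow> real"
    and \<epsilon> :: "nat \<Rightarrow> real" and x v :: "nat \<Rightarrow> 'a" and \<gamma> :: "real \<Rightarrow> 'a"
    and I :: "nat \<Rightarrow> real set" and k :: "nat \<Rightarrow> nat"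
    and \<mu> :: "('a \<times> 'a) measure" and \<kappa> :: "'a \<Rightarrow> 'a measure"
    and U :: "'a set" and \<nu> :: "(real \<Rightarrow>\<^sub>C 'a) measure"
  assumes "locally_Lipschitz f"
    and "step_sizes \<epsilon>"
    and "subgradient_sequence f \<epsilon> x v"
    and "bounded (range x)"
    and "interpolating_curve \<epsilon> x v \<gamma>"
    and "\<And>i. i \<ge> 1 \<Longrightarrow> is_interval (I i) \<and> bounded (I i) \<and> I i \<subseteq> {0..}"
    and "disjoint_family_on I {1..}"
    and "filterlim (\<lambda>i. measure lebesgue (I i)) at_top sequentially"
    and "filterlim k at_top sequentially"
    and "sets \<mu> = sets borel"
    and "weak_star_limit (\<lambda>i. curve_measure \<gamma> (\<Union>j\<in>{1..k i}. I j)) \<mu>"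
    and "disintegration \<mu> \<kappa>"
    and "open U" and "bounded U" and "fst ` measure_support \<mu> \<subseteq> U"
    and "prob_space \<nu>"
    and "sets \<nu> = sets (restrict_space borel (Lip_curves U))"
    and "\<And>t. distr \<nu> \<nu> (translate t) = \<nu>"
    and "\<And>\<phi> :: 'a \<times> 'a \<Rightarrow> real. \<phi> \<in> borel_measurable borel \<Longrightarrow>
           (LINT y|distr \<mu> borel fst. \<phi> (y, centroid \<kappa> y)) =
           (LINT \<beta>|\<nu>. \<phi> (apply_bcontfun \<beta> 0, vector_derivative (apply_bcontfun \<beta>) (at 0)))"
  shows "prob_space \<mu> \<and> closed_measure \<mu> \<and>
    (AE \<beta> in \<nu>. AE t in lebesgue.
       \<exists>w. (apply_bcontfun \<beta> has_vector_derivative w) (at t)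
           \<and> - w \<in> clarke_subdiff f (apply_bcontfun \<beta> t))"
proof -
  interpret subgradient_limit f \<epsilon> x v \<gamma> I k \<mu>
    by unfold_locales (fact assms)+
  interpret stationary_curve_measure \<nu> U
    using assms by (simp add: stationary_curve_measure_def stationary_curve_measure_axioms_def)
  let ?C = "{(x, v). - v \<in> clarke_subdiff f x}"
  \<comment> \<open>Testing the identity with the indicator of the complement of the graph transfers
    the inclusion from centroids to velocities at time 0.\<close>
  let ?\<phi> = "indicator (- ?C) :: 'a \<times> 'a \<Rightarrow> real"
  let ?z = "\<lambda>\<beta>. (apply_bcontfun \<beta> 0, vector_derivative (apply_bcontfun \<beta>) (at 0))"
  have C: "?C \<in> sets borel"
    using closed_neg_clarke_graph[OF assms(1)] by (rule borel_closed)
  have "(LINT y|distr \<mu> borel fst. ?\<phi> (y, centroid \<kappa> y)) = 0"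
    by (rule integral_eq_zero_AE, rule eventually_mono[OF AE_centroid_neg_clarke_graph[OF assms(12)]]) simp
  then have "(LINT \<beta>|\<nu>. ?\<phi> (?z \<beta>)) = 0"
    using assms(19)[of ?\<phi>] C by simp
  \<comment> \<open>Integrability has to be checked before a zero integral says anything: the
    Bochner integral of a nonintegrable function is also 0.\<close>
  moreover have "integrable \<nu> (\<lambda>\<beta>. ?\<phi> (?z \<beta>))"
  proof (rule integrable_const_bound[of _ 1])
    have "?z \<in> borel_measurable \<nu>"
      by (intro borel_measurable_Pair measurable_eval measurable_vector_derivative)
    then show "(\<lambda>\<beta>. ?\<phi> (?z \<beta>)) \<in> borel_measurable \<nu>"
      by (rule measurable_compose) (use C in simp)
  qed (auto simp: indicator_def)
  ultimately have "AE \<beta> in \<nu>. ?\<phi> (?z \<beta>) = 0"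
    by (subst (asm) integral_nonneg_eq_0_iff_AE) (auto simp: indicator_def)
  then have "AE \<beta> in \<nu>. ?z \<beta> \<in> ?C"
    by eventually_elim (simp add: indicator_def split: if_splits)
  from AE_curve_AE_time[OF C this] show ?thesis
    using prob_space_\<mu> closed_measure_\<mu> by simp
qed

end
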